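(* Let $(M,g)$ be an $m$-dimensional Riemannian manifold and $\Omega\subseteq M$ a simply connected open set, with everything below expressed in a given local coordinate system $(x_i)_{i=1,\dots,m}$. Let $\boldsymbol e=(\boldsymbol e_1,\dots,\boldsymbol e_m)$ be a symmetric $m$-vector field of class $C^2$ on $\Omega$, i.e. $\boldsymbol e_i=\sum_{k=1}^m e_{ik}\,\partial_{x_k}$ with $e_{ij}=e_{ji}\in C^2(\Omega)$ for all $i,j=1,\dots,m$. Then the system $$\nabla_{s,g}\boldsymbol V=\boldsymbol e\quad\text{in }\Omega$$ has a solution $\boldsymbol V=(V_1,\dots,V_m)\in C^3(\Omega,\mathbb R^m)$, where the components of the symmetric gradient $\nabla_{s,g}\boldsymbol V$ are $$\frac12\Big(\partial_{x_i}\Big(\sum_{k}g_{jk}V_k\Big)+\partial_{x_j}\Big(\sum_k g_{ik}V_k\Big)\Big),\qquad i,j=1,\dots,m,$$ if and only if the Saint-Venant compatibility relations hold in $\Omega$: $$\partial^2_{x_lx_j}e_{ik}+\partial^2_{x_kx_i}e_{jl}-\partial^2_{x_lx_i}e_{jk}-\partial^2_{x_jx_k}e_{il}=0,\qquad i,j,k,l=1,\dots,m.$$ Moreover, if $x_0\in\Omega$ is fixed and these compatibility relations hold, then the solution of $\nabla_{s,g}\boldsymbol V=\boldsymbol e$ is obtained by $$V_k=\sum_s g^{ks}u_s,\qquad k=1,\dots,m,$$ where $$u_i(x)=c_0^i+\int_0^1\langle \boldsymbol U_i(\gamma(t)),\dot\gamma(t)\rangle_g\,dt,\quad x\in\Omega,\qquad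 \boldsymbol U_i=\sum_{l,s}g^{ls}(p_{is}+e_{is})\,\partial_{x_l},$$ $$p_{ij}(x)=c_0^{ij}+\int_0^1\langle \boldsymbol W_{ij}(\gamma(t)),\dot\gamma(t)\rangle_g\,dt,\quad x\in\Omega,\qquad \boldsymbol W_{ij}=\sum_{l,s}g^{ls}\big(\partial_{x_j}e_{is}-\partial_{x_i}e_{js}\big)\,\partial_{x_l},$$ for some real numbers $c_0^i$, $c_0^{ij}$, and where $\gamma:[0,1]\to\Omega$ is an arbitrarily fixed curve joining $x_0$ with $x\in\Omega$.
   Context: $(g_{ij})$ are the components of the Riemannian metric $g=\langle\cdot,\cdot\rangle_g$ in the given local coordinate system $(x_i)_{i=1,\dots,m}$, and $(g^{ij})=(g_{ij})^{-1}$. The equation $\nabla_{s,g}\boldsymbol V=\boldsymbol e$ means that the $(i,j)$ component of $\nabla_{s,g}\boldsymbol V$ equals $e_{ij}$ for all $i,j$. The functions $e_{ij}$ and $V_k$ are components with respect to the given coordinate system, and all sums run from $1$ to $m$. *)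

theory Defs
  imports "HOL-Analysis.Analysis"
begin

text \<open>
  \<open>C_k_on k S f\<close>: \<open>f\<close> is of class \<open>C\<^sup>k\<close> on \<open>S\<close>; only meant for open \<open>S\<close>.
\<close>

fun C_k_on :: "nat \<Rightarrow> 'a::real_normed_vector set \<Rightarrow> ('a \<Rightarrow> 'b::real_normed_vector) \<Rightarrow> bool" where
  "C_k_on 0 S f \<longleftrightarrow> continuous_on S f"
| "C_k_on (Suc k) S f \<longleftrightarrow>
     (\<forall>x\<in>S. f differentiable (at x)) \<and>
     (\<forall>v. C_k_on k S (\<lambda>x. frechet_derivative f (at x) v))"

text \<open>
  A chart is a pair of its domain and its coordinate map. Coordinates are indexed by the
  finite type \<open>'m\<close>, so the dimension is \<open>CARD('m)\<close>.
\<close>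

type_synonym ('a, 'm) chart = "'a set \<times> ('a \<Rightarrow> real ^ 'm)"

definition chart_inv :: "('a, 'm) chart \<Rightarrow> real ^ 'm \<Rightarrow> 'a" where
  "chart_inv c = the_inv_into (fst c) (snd c)"

definition topological_chart :: "'a::topological_space set \<Rightarrow> ('a, 'm::finite) chart \<Rightarrow> bool" where
  "topological_chart M c \<longleftrightarrow>
     openin (top_of_set M) (fst c) \<and> open (snd c ` fst c) \<and>
     homeomorphism (fst c) (snd c ` fst c) (snd c) (chart_inv c)"

definition transition :: "('a, 'm) chart \<Rightarrow> ('a, 'm) chart \<Rightarrow> real ^ 'm \<Rightarrow> real ^ 'm" where
  "transition c d = snd d \<circ> chart_inv c"

text \<open>
  The atlas \<open>A\<close> need not be maximal. The manifold is a subset \<open>M\<close> of a topological space,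
  with the subspace topology.
\<close>

locale smooth_manifold =
  fixes M :: "'a::{t2_space, second_countable_topology} set"
    and A :: "('a, 'm::finite) chart set"
  assumes covers: "(\<Union>c\<in>A. fst c) = M"
    and charts: "c \<in> A \<Longrightarrow> topological_chart M c"
    and smooth_transition:
      "c \<in> A \<Longrightarrow> d \<in> A \<Longrightarrow> C_k_on k (snd c ` (fst c \<inter> fst d)) (transition c d)"

text \<open>
  A Riemannian metric is given by its components: \<open>g c p $ i $ j\<close> is the \<open>(i,j)\<close> component at
  the point \<open>p\<close> with respect to the chart \<open>c\<close>. The assumption \<open>covariant\<close> is the transformation
  law of a twice covariant tensor field, so that the inner product on the tangent space at \<open>p\<close>
  does not depend on the chart.
\<close>

locale riemannian_manifold = smooth_manifold M A
  for M :: "'a::{t2_space, second_countable_topology} set"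
    and A :: "('a, 'm::finite) chart set" +
  fixes g :: "('a, 'm) chart \<Rightarrow> 'a \<Rightarrow> real ^ 'm ^ 'm"
  assumes symmetric: "c \<in> A \<Longrightarrow> p \<in> fst c \<Longrightarrow> g c p $ i $ j = g c p $ j $ i"
    and positive_definite: "c \<in> A \<Longrightarrow> p \<in> fst c \<Longrightarrow> v \<noteq> 0 \<Longrightarrow> v \<bullet> (g c p *v v) > 0"
    and smooth_metric: "c \<in> A \<Longrightarrow> C_k_on k (snd c ` fst c) (g c \<circ> chart_inv c)"
    and covariant: "c \<in> A \<Longrightarrow> d \<in> A \<Longrightarrow> p \<in> fst c \<inter> fst d \<Longrightarrow>
      g c p =
        (let J = matrix (frechet_derivative (transition c d) (at (snd c p)))
         in transpose J ** g d p ** J)"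

definition C_k_in_chart ::
  "nat \<Rightarrow> ('a, 'm::finite) chart \<Rightarrow> 'a set \<Rightarrow> ('a \<Rightarrow> 'b::real_normed_vector) \<Rightarrow> bool" where
  "C_k_in_chart k c S f \<longleftrightarrow> C_k_on k (snd c ` S) (f \<circ> chart_inv c)"

definition partial :: "('a, 'm::finite) chart \<Rightarrow> 'm \<Rightarrow> ('a \<Rightarrow> real) \<Rightarrow> 'a \<Rightarrow> real" where
  "partial c i f p = frechet_derivative (f \<circ> chart_inv c) (at (snd c p)) (axis i 1)"

text \<open>
  From here on vector fields are represented by their components in a fixed chart \<open>c\<close>, and
  \<open>G\<close> is the matrix field of the components of the metric in that chart. An \<open>m\<close>-vector field
  \<open>e\<close> is represented by \<open>e p $ i $ k\<close>, the \<open>k\<close>-th component of its \<open>i\<close>-th vector field.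
\<close>

definition sym_grad ::
  "('a, 'm::finite) chart \<Rightarrow> ('a \<Rightarrow> real ^ 'm ^ 'm) \<Rightarrow> ('a \<Rightarrow> real ^ 'm) \<Rightarrow> 'a \<Rightarrow> real ^ 'm ^ 'm" where
  "sym_grad c G V p = (\<chi> i j.
     1 / 2 * (partial c i (\<lambda>q. \<Sum>k\<in>UNIV. G q $ j $ k * V q $ k) p +
              partial c j (\<lambda>q. \<Sum>k\<in>UNIV. G q $ i $ k * V q $ k) p))"

definition saint_venant ::
  "('a, 'm::finite) chart \<Rightarrow> 'a set \<Rightarrow> ('a \<Rightarrow> real ^ 'm ^ 'm) \<Rightarrow> bool" where
  "saint_venant c \<Omega> e \<longleftrightarrow> (\<forall>p\<in>\<Omega>. \<forall>i j k l.
       partial c l (partial c j (\<lambda>q. e q $ i $ k)) p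
     + partial c k (partial c i (\<lambda>q. e q $ j $ l)) p
     - partial c l (partial c i (\<lambda>q. e q $ j $ k)) p
     - partial c j (partial c k (\<lambda>q. e q $ i $ l)) p = 0)"

definition metric_inner :: "real ^ 'm ^ 'm \<Rightarrow> real ^ 'm \<Rightarrow> real ^ 'm::finite \<Rightarrow> real" where
  "metric_inner G v w = (\<Sum>i\<in>UNIV. \<Sum>j\<in>UNIV. G $ i $ j * v $ i * w $ j)"

definition velocity :: "('a, 'm::finite) chart \<Rightarrow> (real \<Rightarrow> 'a) \<Rightarrow> real \<Rightarrow> real ^ 'm" where
  "velocity c \<gamma> t = vector_derivative (snd c \<circ> \<gamma>) (at t within {0..1})"

definition curve_integral ::
  "('a, 'm::finite) chart \<Rightarrow> ('a \<Rightarrow> real ^ 'm ^ 'm) \<Rightarrow> ('a \<Rightarrow> real ^ 'm) \<Rightarrow> (real \<Rightarrow> 'a) \<Rightarrow> real" where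
  "curve_integral c G X \<gamma> =
     integral {0..1} (\<lambda>t. metric_inner (G (\<gamma> t)) (X (\<gamma> t)) (velocity c \<gamma> t))"

text \<open>Curves are piecewise continuously differentiable.\<close>

definition curve_joining ::
  "('a::topological_space, 'm::finite) chart \<Rightarrow> 'a set \<Rightarrow> 'a \<Rightarrow> 'a \<Rightarrow> (real \<Rightarrow> 'a) \<Rightarrow> bool" where
  "curve_joining c \<Omega> x\<^sub>0 x \<gamma> \<longleftrightarrow>
     path \<gamma> \<and> valid_path (snd c \<circ> \<gamma>) \<and> path_image \<gamma> \<subseteq> \<Omega> \<and>
     pathstart \<gamma> = x\<^sub>0 \<and> pathfinish \<gamma> = x"

text \<open>
  \<open>\<gamma> x\<close> is the curve chosen for the end point \<open>x\<close>, and \<open>a\<close>,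
  \<open>b\<close> are the integration constants of \<open>u\<close> and \<open>p\<close>.
\<close>

definition W_field ::
  "('a, 'm::finite) chart \<Rightarrow> ('a \<Rightarrow> real ^ 'm ^ 'm) \<Rightarrow> ('a \<Rightarrow> real ^ 'm ^ 'm) \<Rightarrow>
   'm \<Rightarrow> 'm \<Rightarrow> 'a \<Rightarrow> real ^ 'm" where
  "W_field c G e i j p = (\<chi> l. \<Sum>s\<in>UNIV. matrix_inv (G p) $ l $ s *
     (partial c j (\<lambda>q. e q $ i $ s) p - partial c i (\<lambda>q. e q $ j $ s) p))"

definition p_coeff ::
  "('a, 'm::finite) chart \<Rightarrow> ('a \<Rightarrow> real ^ 'm ^ 'm) \<Rightarrow> ('a \<Rightarrow> real ^ 'm ^ 'm) \<Rightarrow>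
   ('a \<Rightarrow> real \<Rightarrow> 'a) \<Rightarrow> real ^ 'm ^ 'm \<Rightarrow> 'm \<Rightarrow> 'm \<Rightarrow> 'a \<Rightarrow> real" where
  "p_coeff c G e \<gamma> b i j x = b $ i $ j + curve_integral c G (W_field c G e i j) (\<gamma> x)"

definition U_field ::
  "('a, 'm::finite) chart \<Rightarrow> ('a \<Rightarrow> real ^ 'm ^ 'm) \<Rightarrow> ('a \<Rightarrow> real ^ 'm ^ 'm) \<Rightarrow>
   ('a \<Rightarrow> real \<Rightarrow> 'a) \<Rightarrow> real ^ 'm ^ 'm \<Rightarrow> 'm \<Rightarrow> 'a \<Rightarrow> real ^ 'm" where
  "U_field c G e \<gamma> b i p = (\<chi> l. \<Sum>s\<in>UNIV. matrix_inv (G p) $ l $ s *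
     (p_coeff c G e \<gamma> b i s p + e p $ i $ s))"

definition u_coeff ::
  "('a, 'm::finite) chart \<Rightarrow> ('a \<Rightarrow> real ^ 'm ^ 'm) \<Rightarrow> ('a \<Rightarrow> real ^ 'm ^ 'm) \<Rightarrow>
   ('a \<Rightarrow> real \<Rightarrow> 'a) \<Rightarrow> real ^ 'm \<Rightarrow> real ^ 'm ^ 'm \<Rightarrow> 'm \<Rightarrow> 'a \<Rightarrow> real" where
  "u_coeff c G e \<gamma> a b i x = a $ i + curve_integral c G (U_field c G e \<gamma> b i) (\<gamma> x)"

definition V_formula ::
  "('a, 'm::finite) chart \<Rightarrow> ('a \<Rightarrow> real ^ 'm ^ 'm) \<Rightarrow> ('a \<Rightarrow> real ^ 'm ^ 'm) \<Rightarrow>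
   ('a \<Rightarrow> real \<Rightarrow> 'a) \<Rightarrow> real ^ 'm \<Rightarrow> real ^ 'm ^ 'm \<Rightarrow> 'a \<Rightarrow> real ^ 'm" where
  "V_formula c G e \<gamma> a b x =
     (\<chi> k. \<Sum>s\<in>UNIV. matrix_inv (G x) $ k $ s * u_coeff c G e \<gamma> a b s x)"

definition is_solution ::
  "('a, 'm::finite) chart \<Rightarrow> ('a \<Rightarrow> real ^ 'm ^ 'm) \<Rightarrow> 'a set \<Rightarrow> ('a \<Rightarrow> real ^ 'm ^ 'm) \<Rightarrow>
   ('a \<Rightarrow> real ^ 'm) \<Rightarrow> bool" where
  "is_solution c G \<Omega> e V \<longleftrightarrow> C_k_in_chart 3 c \<Omega> V \<and> (\<forall>p\<in>\<Omega>. sym_grad c G V p = e p)"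

end

theory Submission
  imports Defs
begin

text \<open>
  In the coordinates of the chart, let \<open>u = g V\<close> be the covariant components of \<open>V\<close>. The metric
  disappears: the system reads \<open>(\<partial>\<^sub>i u\<^sub>j + \<partial>\<^sub>j u\<^sub>i) / 2 = e\<^sub>i\<^sub>j\<close>, and raising the index of an integrand and
  pairing it with \<open>g\<close> turns the curve integrals into Euclidean ones. Put
  \<open>p\<^sub>i\<^sub>j = (\<partial>\<^sub>j u\<^sub>i - \<partial>\<^sub>i u\<^sub>j) / 2\<close>. Then \<open>\<partial>\<^sub>s p\<^sub>i\<^sub>j = \<partial>\<^sub>j e\<^sub>i\<^sub>s - \<partial>\<^sub>i e\<^sub>j\<^sub>s\<close> and \<open>\<partial>\<^sub>s u\<^sub>i = p\<^sub>i\<^sub>s + e\<^sub>i\<^sub>s\<close>. The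
  Saint-Venant relations say that the first of these fields is closed, and the second is closed as
  soon as \<open>p\<close> solves the first equation. So both can be integrated in turn on a simply connected set.

  A closed field has a potential near every point. Along a continuous map \<open>h\<close> from a square one can
  glue the pulled-back local potentials to a function that is unique up to a constant. Applied to
  homotopies of paths, this defines a global potential on a simply connected open set without
  integrating along curves that are merely continuous.
\<close>

section \<open>Functions of class \<open>C\<^sup>k\<close>\<close>

text \<open>Also true where neither function is differentiable: \<open>frechet_derivative\<close> is
  a choice among the derivatives at the point, and both functions have the same candidates
  there.\<close>

lemma frechet_derivative_cong_open:
  assumes "open S" "x \<in> S" "\<And>y. y \<in> S \<Longrightarrow> f y = g y"
  shows "frechet_derivative f (at x) = frechet_derivative g (at x)"
proof -
  have "(f has_derivative D) (at x) \<longleftrightarrow> (g has_derivative D) (at x)" for D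
    using has_derivative_transform_within_open[OF _ assms(1,2)] assms(3) by metis
  then show ?thesis by (simp add: frechet_derivative_def)
qed

lemma C_k_on_cong:
  assumes "open S" "\<And>y. y \<in> S \<Longrightarrow> f y = g y"
  shows "C_k_on k S f \<longleftrightarrow> C_k_on k S g"
  using assms(2)
proof (induction k arbitrary: f g)
  case 0
  then show ?case by (simp cong: continuous_on_cong)
next
  case (Suc k)
  have "f differentiable (at x) \<longleftrightarrow> g differentiable (at x)" if "x \<in> S" for x
    using has_derivative_transform_within_open[OF _ assms(1) that] Suc.prems
    unfolding differentiable_def by metis
  moreover have "C_k_on k S (\<lambda>x. frechet_derivative f (at x) v) \<longleftrightarrow>
      C_k_on k S (\<lambda>x. frechet_derivative g (at x) v)" for v
    by (rule Suc.IH) (metis assms(1) frechet_derivative_cong_open Suc.prems)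
  ultimately show ?case by simp
qed

lemma C_k_on_empty: "C_k_on k {} f"
  by (induction k arbitrary: f) auto

lemma C_k_on_subset: "C_k_on k S f \<Longrightarrow> T \<subseteq> S \<Longrightarrow> C_k_on k T f"
  by (induction k arbitrary: f) (auto intro: continuous_on_subset)

lemma C_k_on_Suc_imp: "C_k_on (Suc k) S f \<Longrightarrow> C_k_on k S f"
proof (induction k arbitrary: f)
  case 0
  then show ?case
    by (auto intro!: continuous_at_imp_continuous_on differentiable_imp_continuous_within)
next
  case (Suc k)
  from Suc.prems show ?case
    unfolding C_k_on.simps(2)[of "Suc k"] using Suc.IH by (subst C_k_on.simps) blast
qed

lemma C_k_on_le: "C_k_on n S f \<Longrightarrow> k \<le> n \<Longrightarrow> C_k_on k S f"
  by (induction n) (auto simp: le_Suc_eq simp del: C_k_on.simps(2) dest: C_k_on_Suc_imp)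

text \<open>Derivatives are unique, so any explicit family \<open>f'\<close> agrees with
  \<open>frechet_derivative\<close> on \<open>S\<close>. The induction steps below verify
  differentiation rules in this form.\<close>

lemma C_k_on_SucI:
  assumes "open S" "\<And>x. x \<in> S \<Longrightarrow> (f has_derivative f' x) (at x)"
    and "\<And>v. C_k_on k S (\<lambda>x. f' x v)"
  shows "C_k_on (Suc k) S f"
proof -
  have "C_k_on k S (\<lambda>x. frechet_derivative f (at x) v)" for v
    using assms(3)[of v] C_k_on_cong[OF assms(1), of "\<lambda>x. frechet_derivative f (at x) v" "\<lambda>x. f' x v"]
      frechet_derivative_at[OF assms(2)] by metis
  with assms(2) show ?thesis by (auto simp: differentiable_def)
qed

lemma C_k_on_Suc_has_derivative:
  assumes "C_k_on (Suc k) S f" "x \<in> S"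
  shows "(f has_derivative frechet_derivative f (at x)) (at x)"
  using assms by (simp flip: frechet_derivative_works)

lemma C_k_on_const: "open S \<Longrightarrow> C_k_on k S (\<lambda>_. a)"
proof (induction k arbitrary: a)
  case (Suc k)
  then show ?case by (intro C_k_on_SucI[where f'="\<lambda>_ _. 0"]) auto
qed auto

lemma C_k_on_bounded_linear:
  assumes "bounded_linear L" "open S" "C_k_on k S f"
  shows "C_k_on k S (\<lambda>x. L (f x))"
  using assms(3)
proof (induction k arbitrary: f)
  case 0
  then show ?case using bounded_linear.continuous_on[OF assms(1)] by simp
next
  case (Suc k)
  show ?case
  proof (rule C_k_on_SucI[OF \<open>open S\<close>])
    show "((\<lambda>x. L (f x)) has_derivative (\<lambda>v. L (frechet_derivative f (at x) v))) (at x)" if "x \<in> S" for x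
      using bounded_linear.has_derivative[OF assms(1) C_k_on_Suc_has_derivative[OF Suc.prems that]] .
    show "C_k_on k S (\<lambda>x. L (frechet_derivative f (at x) v))" for v
      using Suc by simp
  qed
qed

lemma C_k_on_add:
  assumes "open S" "C_k_on k S f" "C_k_on k S g"
  shows "C_k_on k S (\<lambda>x. f x + g x)"
  using assms(2,3)
proof (induction k arbitrary: f g)
  case 0
  then show ?case by (auto intro: continuous_intros)
next
  case (Suc k)
  show ?case
  proof (rule C_k_on_SucI[OF \<open>open S\<close>])
    show "((\<lambda>x. f x + g x) has_derivative
        (\<lambda>v. frechet_derivative f (at x) v + frechet_derivative g (at x) v)) (at x)" if "x \<in> S" for x
      using Suc.prems that by (intro has_derivative_add C_k_on_Suc_has_derivative)
    show "C_k_on k S (\<lambda>x. frechet_derivative f (at x) v + frechet_derivative g (at x) v)" for v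
      using Suc by simp
  qed
qed

lemma C_k_on_mult:
  fixes f g :: "'a::real_normed_vector \<Rightarrow> real"
  assumes "open S" "C_k_on k S f" "C_k_on k S g"
  shows "C_k_on k S (\<lambda>x. f x * g x)"
  using assms(2,3)
proof (induction k arbitrary: f g)
  case 0
  then show ?case by (auto intro: continuous_intros)
next
  case (Suc k)
  show ?case
  proof (rule C_k_on_SucI[OF \<open>open S\<close>])
    show "((\<lambda>x. f x * g x) has_derivative
        (\<lambda>v. f x * frechet_derivative g (at x) v + frechet_derivative f (at x) v * g x)) (at x)"
      if "x \<in> S" for x
      using Suc.prems that by (intro has_derivative_mult C_k_on_Suc_has_derivative)
    \<comment> \<open>The product rule keeps undifferentiated factors, so \<open>f\<close> and
      \<open>g\<close> are lowered to class \<open>k\<close> before the induction hypothesis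
      applies.\<close>
    have "C_k_on k S f" "C_k_on k S g" using Suc.prems C_k_on_Suc_imp by blast+
    then show "C_k_on k S (\<lambda>x. f x * frechet_derivative g (at x) v + frechet_derivative f (at x) v * g x)" for v
      using Suc by (intro C_k_on_add[OF \<open>open S\<close>] Suc.IH) simp_all
  qed
qed

lemma C_k_on_diff:
  fixes f g :: "'a::real_normed_vector \<Rightarrow> real"
  assumes "open S" "C_k_on k S f" "C_k_on k S g"
  shows "C_k_on k S (\<lambda>x. f x - g x)"
  using C_k_on_add[OF assms(1,2) C_k_on_bounded_linear[OF bounded_linear_minus[OF bounded_linear_ident] assms(1,3)]]
  by simp

lemma C_k_on_sum:
  assumes "open S" "\<And>i. i \<in> I \<Longrightarrow> C_k_on k S (f i)"
  shows "C_k_on k S (\<lambda>x. \<Sum>i\<in>I. f i x)"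
  using assms(2)
proof (induction I rule: infinite_finite_induct)
  case (insert i I)
  then show ?case by (simp add: C_k_on_add[OF assms(1)])
qed (simp_all add: C_k_on_const assms(1))

lemma C_k_on_prod:
  fixes f :: "'i \<Rightarrow> 'a::real_normed_vector \<Rightarrow> real"
  assumes "open S" "\<And>i. i \<in> I \<Longrightarrow> C_k_on k S (f i)"
  shows "C_k_on k S (\<lambda>x. \<Prod>i\<in>I. f i x)"
  using assms(2)
proof (induction I rule: infinite_finite_induct)
  case (insert i I)
  then show ?case by (simp add: C_k_on_mult[OF assms(1)])
qed (simp_all add: C_k_on_const assms(1))

lemma C_k_on_inverse:
  fixes f :: "'a::real_normed_vector \<Rightarrow> real"
  assumes "open S" "\<And>x. x \<in> S \<Longrightarrow> f x \<noteq> 0" "C_k_on k S f"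
  shows "C_k_on k S (\<lambda>x. inverse (f x))"
  using assms(3)
proof (induction k)
  case 0
  then show ?case using assms(2) by (auto intro: continuous_intros)
next
  case (Suc k)
  show ?case
  proof (rule C_k_on_SucI[OF \<open>open S\<close>])
    show "((\<lambda>x. inverse (f x)) has_derivative
        (\<lambda>v. - (inverse (f x) * frechet_derivative f (at x) v * inverse (f x)))) (at x)" if "x \<in> S" for x
      using Suc.prems that assms(2) by (intro Deriv.has_derivative_inverse C_k_on_Suc_has_derivative) auto
    \<comment> \<open>The derivative of the inverse contains the inverse itself, whose class
      \<open>k\<close> is the induction hypothesis.\<close>
    have "C_k_on k S (\<lambda>x. inverse (f x))" using Suc C_k_on_Suc_imp by blast
    then show "C_k_on k S (\<lambda>x. - (inverse (f x) * frechet_derivative f (at x) v * inverse (f x)))" for v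
      using Suc.prems
      by (intro C_k_on_mult C_k_on_bounded_linear[OF bounded_linear_minus[OF bounded_linear_ident]] \<open>open S\<close>) simp_all
  qed
qed

lemma C_k_on_vec_nth: "open S \<Longrightarrow> C_k_on k S f \<Longrightarrow> C_k_on k S (\<lambda>x. f x $ i)"
  by (rule C_k_on_bounded_linear[OF bounded_linear_vec_nth])

lemma C_k_on_vecI:
  fixes f :: "'a::real_normed_vector \<Rightarrow> real ^ 'n"
  assumes "open S" "\<And>i. C_k_on k S (\<lambda>x. f x $ i)"
  shows "C_k_on k S f"
proof -
  have "C_k_on k S (\<lambda>x. \<Sum>i\<in>UNIV. f x $ i *\<^sub>R axis i (1::real))"
    using assms by (intro C_k_on_sum C_k_on_bounded_linear[OF bounded_linear_scaleR_left])
  moreover have "(\<Sum>i\<in>UNIV. f x $ i *\<^sub>R axis i 1) = f x" for x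
    using basis_expansion[of "f x"] by (simp add: scalar_mult_eq_scaleR)
  ultimately show ?thesis by simp
qed

section \<open>Inverse matrices and determinants as functions of class \<open>C^k\<close>\<close>

lemma matrix_inv_mult:
  fixes A :: "'a::semiring_1 ^ 'n ^ 'm"
  assumes "invertible A"
  shows "A ** matrix_inv A = mat 1" "matrix_inv A ** A = mat 1"
  using someI_ex[OF assms[unfolded invertible_def]] unfolding matrix_inv_def by auto

text \<open>Cramer's rule, applied to column \<open>s\<close> of the inverse, which solves the
  linear system with the unit vector \<open>axis s 1\<close> on the right. It makes the entries of
  the inverse rational functions of those of \<open>A\<close>.\<close>

lemma matrix_inv_nth:
  fixes A :: "real ^ 'n ^ 'n"
  assumes "det A \<noteq> 0"
  shows "matrix_inv A $ k $ s = det (\<chi> i j. if j = k then axis s 1 $ i else A $ i $ j) / det A"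
proof -
  have "A *v (matrix_inv A *v axis s 1) = axis s 1"
    using assms by (simp add: matrix_vector_mul_assoc matrix_inv_mult invertible_det_nz)
  then have "matrix_inv A *v axis s 1 = (\<chi> k. det (\<chi> i j. if j = k then axis s 1 $ i else A $ i $ j) / det A)"
    using cramer[OF assms] by blast
  then show ?thesis
    by (metis (no_types, lifting) column_def matrix_vector_mult_basis vec_lambda_beta)
qed

lemma C_k_on_det:
  fixes A :: "'a::real_normed_vector \<Rightarrow> real ^ 'n ^ 'n"
  assumes "open S" "\<And>i j. C_k_on k S (\<lambda>x. A x $ i $ j)"
  shows "C_k_on k S (\<lambda>x. det (A x))"
  unfolding det_def using assms
  by (intro C_k_on_sum C_k_on_mult C_k_on_prod C_k_on_const)

lemma C_k_on_matrix_inv: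
  fixes A :: "'a::real_normed_vector \<Rightarrow> real ^ 'n ^ 'n"
  assumes "open S" "\<And>i j. C_k_on k S (\<lambda>x. A x $ i $ j)" "\<And>x. x \<in> S \<Longrightarrow> det (A x) \<noteq> 0"
  shows "C_k_on k S (\<lambda>x. matrix_inv (A x) $ i $ j)"
proof -
  \<comment> \<open>The numerator matrix of Cramer's rule: its entries are constants in column
    \<open>i\<close> and entries of \<open>A\<close> elsewhere.\<close>
  let ?B = "\<lambda>x. \<chi> r c. if c = i then axis j 1 $ r else A x $ r $ c"
  have "C_k_on k S (\<lambda>x. ?B x $ r $ c)" for r c
    using assms(1,2) by (cases "c = i") (auto intro: C_k_on_const)
  then have "C_k_on k S (\<lambda>x. det (?B x) * inverse (det (A x)))"
    using assms by (intro C_k_on_mult C_k_on_inverse C_k_on_det)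
  then show ?thesis
    using assms by (subst C_k_on_cong[OF \<open>open S\<close>]) (auto simp: matrix_inv_nth divide_inverse)
qed

text \<open>A function is one class better than its gradient; this is how potentials gain regularity
  below.\<close>

lemma C_k_on_Suc_gradient:
  fixes f :: "real ^ 'n \<Rightarrow> real"
  assumes "open S" "\<And>x. x \<in> S \<Longrightarrow> (f has_derivative (\<lambda>v. w x \<bullet> v)) (at x)"
    and "\<And>i. C_k_on k S (\<lambda>x. w x $ i)"
  shows "C_k_on (Suc k) S f"
proof (rule C_k_on_SucI[OF assms(1,2)])
  show "C_k_on k S (\<lambda>x. w x \<bullet> v)" for v
    unfolding inner_vec_def inner_real_def
    using assms by (intro C_k_on_sum C_k_on_mult C_k_on_const)
qed

section \<open>Symmetry of second derivatives\<close>

text \<open>Two applications of the mean value theorem, first along \<open>u\<close> and then along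
  \<open>v\<close>. The left-hand side is symmetric in \<open>u\<close> and \<open>v\<close>, which
  leads to the symmetry of mixed derivatives.\<close>

lemma second_difference_mean_value:
  fixes f :: "'a::real_normed_vector \<Rightarrow> real"
  assumes C2: "C_k_on 2 S f" and sub: "ball x d \<subseteq> S"
    and h: "h > 0" "h * (norm u + norm v) < d"
  shows "\<exists>p\<in>ball x d. f (x + h *\<^sub>R u + h *\<^sub>R v) - f (x + h *\<^sub>R u) - f (x + h *\<^sub>R v) + f x =
    h * h * frechet_derivative (\<lambda>y. frechet_derivative f (at y) u) (at p) v"
proof -
  let ?F = "\<lambda>y. frechet_derivative f (at y) u"
  have C: "C_k_on (Suc 1) S f" using C2 by (simp add: numeral_2_eq_2)
  then have CF: "C_k_on (Suc 0) S ?F" by simp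
  have mem: "x + s *\<^sub>R u + t *\<^sub>R v \<in> ball x d" if "0 \<le> s" "s \<le> h" "0 \<le> t" "t \<le> h" for s t
  proof -
    have "norm (s *\<^sub>R u + t *\<^sub>R v) \<le> s * norm u + t * norm v"
      using that by (intro norm_triangle_le) simp
    also have "\<dots> \<le> h * norm u + h * norm v"
      using that by (intro add_mono mult_right_mono) auto
    also have "\<dots> < d" using h(2) by (simp add: algebra_simps)
    finally show ?thesis by (simp add: dist_norm algebra_simps norm_minus_commute)
  qed
  \<comment> \<open>The second difference is \<open>g h - g 0\<close>.\<close>
  define g where "g s = f (x + s *\<^sub>R u + h *\<^sub>R v) - f (x + s *\<^sub>R u)" for s
  have "(g has_derivative (\<lambda>a. a * (?F (x + s *\<^sub>R u + h *\<^sub>R v) - ?F (x + s *\<^sub>R u)))) (at s within {0..h})"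
    if s: "0 \<le> s" "s \<le> h" for s
  proof -
    have "((\<lambda>s. f (x + s *\<^sub>R u + t *\<^sub>R v)) has_derivative (\<lambda>a. a * ?F (x + s *\<^sub>R u + t *\<^sub>R v))) (at s)"
      if "0 \<le> t" "t \<le> h" for t
    proof -
      let ?p = "x + s *\<^sub>R u + t *\<^sub>R v"
      have f: "(f has_derivative frechet_derivative f (at ?p)) (at ?p)"
        using C_k_on_Suc_has_derivative[OF C] mem[OF s that] sub by blast
      have "((\<lambda>s. x + s *\<^sub>R u + t *\<^sub>R v) has_derivative (\<lambda>a. a *\<^sub>R u)) (at s)"
        by (auto intro!: derivative_eq_intros)
      from has_derivative_compose[OF this f]
      show ?thesis
        using linear_cmul[OF has_derivative_linear[OF f]] by simp
    qed
    from has_derivative_diff[OF this[of h] this[of 0]] h(1)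
    show ?thesis
      unfolding g_def by (auto simp: right_diff_distrib intro: has_derivative_at_withinI)
  qed
  then obtain s where s: "s \<in> {0<..<h}"
    "g h - g 0 = h * (?F (x + s *\<^sub>R u + h *\<^sub>R v) - ?F (x + s *\<^sub>R u))"
    using mvt_simple[OF h(1), of g "\<lambda>s a. a * (?F (x + s *\<^sub>R u + h *\<^sub>R v) - ?F (x + s *\<^sub>R u))"] by auto
  \<comment> \<open>The slope of \<open>g\<close> at the intermediate point \<open>s\<close> is
    \<open>k h - k 0\<close>, which calls for the second mean value step.\<close>
  define k where "k t = ?F (x + s *\<^sub>R u + t *\<^sub>R v)" for t
  have "(k has_derivative (\<lambda>a. a * frechet_derivative ?F (at (x + s *\<^sub>R u + t *\<^sub>R v)) v)) (at t within {0..h})"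
    if t: "0 \<le> t" "t \<le> h" for t
  proof (rule has_derivative_at_withinI)
    let ?p = "x + s *\<^sub>R u + t *\<^sub>R v"
    have F: "(?F has_derivative frechet_derivative ?F (at ?p)) (at ?p)"
      using C_k_on_Suc_has_derivative[OF CF] mem[OF _ _ t, of s] s(1) sub by auto
    have "((\<lambda>t. x + s *\<^sub>R u + t *\<^sub>R v) has_derivative (\<lambda>a. a *\<^sub>R v)) (at t)"
      by (auto intro!: derivative_eq_intros)
    from has_derivative_compose[OF this F]
    show "(k has_derivative (\<lambda>a. a * frechet_derivative ?F (at ?p) v)) (at t)"
      unfolding k_def using linear_cmul[OF has_derivative_linear[OF F]] by simp
  qed
  then obtain t where t: "t \<in> {0<..<h}"
    "k h - k 0 = h * frechet_derivative ?F (at (x + s *\<^sub>R u + t *\<^sub>R v)) v"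
    using mvt_simple[OF h(1), of k "\<lambda>t a. a * frechet_derivative ?F (at (x + s *\<^sub>R u + t *\<^sub>R v)) v"] by auto
  show ?thesis
  proof
    show "x + s *\<^sub>R u + t *\<^sub>R v \<in> ball x d" using mem s(1) t(1) by simp
    show "f (x + h *\<^sub>R u + h *\<^sub>R v) - f (x + h *\<^sub>R u) - f (x + h *\<^sub>R v) + f x =
        h * h * frechet_derivative ?F (at (x + s *\<^sub>R u + t *\<^sub>R v)) v"
      using s(2) t(2) by (simp add: g_def k_def)
  qed
qed

text \<open>Schwarz's theorem. The two mixed derivatives take a common value at two points
  arbitrarily close to \<open>x\<close>, and by continuity they agree at \<open>x\<close>.\<close>

lemma frechet_derivative_commute:
  fixes f :: "'a::real_normed_vector \<Rightarrow> real"
  assumes C2: "C_k_on 2 S f" and S: "open S" "x \<in> S"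
  shows "frechet_derivative (\<lambda>y. frechet_derivative f (at y) u) (at x) v =
    frechet_derivative (\<lambda>y. frechet_derivative f (at y) v) (at x) u"
proof (rule ccontr)
  define D where "D u v p = frechet_derivative (\<lambda>y. frechet_derivative f (at y) u) (at p) v" for u v p
  assume "\<not> ?thesis"
  \<comment> \<open>With half of the supposed gap as tolerance, values near the two mixed
    derivatives cannot coincide.\<close>
  then have pos: "\<bar>D u v x - D v u x\<bar> / 2 > 0" (is "?e > 0") by (simp add: D_def)
  have "continuous_on S (D u v)" for u v
    using C2 unfolding D_def by (simp add: numeral_2_eq_2)
  then have "\<exists>d>0. \<forall>p. dist p x < d \<longrightarrow> dist (D u v p) (D u v x) < ?e" for u v
    using pos S(2) unfolding continuous_on_eq_continuous_at[OF S(1)] continuous_at_eps_delta by blast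
  then obtain d\<^sub>1 d\<^sub>2 where d: "d\<^sub>1 > 0" "d\<^sub>2 > 0"
    "\<And>p. dist p x < d\<^sub>1 \<Longrightarrow> dist (D u v p) (D u v x) < ?e"
    "\<And>p. dist p x < d\<^sub>2 \<Longrightarrow> dist (D v u p) (D v u x) < ?e" by meson
  obtain r where r: "r > 0" "ball x r \<subseteq> S" using openE[OF S] by blast
  define \<delta> where "\<delta> = min r (min d\<^sub>1 d\<^sub>2)"
  have \<delta>: "\<delta> > 0" "ball x \<delta> \<subseteq> S" using d r by (auto simp: \<delta>_def)
  \<comment> \<open>The summand 1 keeps the quotient defined for \<open>u = v = 0\<close> and makes
    the parallelogram with sides \<open>h u\<close> and \<open>h v\<close> fit strictly into the
    ball.\<close>
  define h where "h = \<delta> / (norm u + norm v + 1)"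
  have n: "norm u + norm v + 1 > 0" by (simp add: add_nonneg_pos)
  have h: "h > 0" "h * (norm u + norm v) < \<delta>"
    using \<delta>(1) n by (simp_all add: h_def field_simps)
  obtain p where p: "p \<in> ball x \<delta>"
    "f (x + h *\<^sub>R u + h *\<^sub>R v) - f (x + h *\<^sub>R u) - f (x + h *\<^sub>R v) + f x = h * h * D u v p"
    using second_difference_mean_value[OF C2 \<delta>(2) h] unfolding D_def by blast
  obtain q where q: "q \<in> ball x \<delta>"
    "f (x + h *\<^sub>R v + h *\<^sub>R u) - f (x + h *\<^sub>R v) - f (x + h *\<^sub>R u) + f x = h * h * D v u q"
    using second_difference_mean_value[OF C2 \<delta>(2) h(1), of v u] h(2) unfolding D_def by (auto simp: add.commute)
  have "x + h *\<^sub>R v + h *\<^sub>R u = x + h *\<^sub>R u + h *\<^sub>R v" by simp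
  with p(2) q(2) have "h * h * D u v p = h * h * D v u q" by (simp add: algebra_simps)
  with h(1) have "D u v p = D v u q" by simp
  moreover have "dist (D u v p) (D u v x) < ?e" "dist (D v u q) (D v u x) < ?e"
    using d(3)[of p] d(4)[of q] p(1) q(1) by (auto simp: \<delta>_def dist_commute)
  ultimately show False by (simp add: dist_real_def abs_if split: if_splits)
qed

section \<open>Potentials on simply connected sets\<close>

definition potential_on :: "'n::real_inner set \<Rightarrow> ('n \<Rightarrow> 'n) \<Rightarrow> ('n \<Rightarrow> real) \<Rightarrow> bool" where
  "potential_on S w f \<longleftrightarrow> (\<forall>y\<in>S. (f has_derivative (\<lambda>v. w y \<bullet> v)) (at y))"

text \<open>
  \<open>\<Phi>\<close> differs from \<open>F \<circ> h\<close> by a local constant, for every local potential \<open>F\<close> of \<open>w\<close>. For a path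
  \<open>h\<close>, the increment of \<open>\<Phi>\<close> plays the role of the line integral of \<open>w\<close> along \<open>h\<close>.
\<close>

definition primitive_along ::
  "('n::real_inner \<Rightarrow> 'n) \<Rightarrow> ('t::topological_space \<Rightarrow> 'n) \<Rightarrow> 't set \<Rightarrow> ('t \<Rightarrow> real) \<Rightarrow> bool" where
  "primitive_along w h K \<Phi> \<longleftrightarrow>
     (\<forall>t\<in>K. \<forall>B F. open B \<longrightarrow> h t \<in> B \<longrightarrow> potential_on B w F \<longrightarrow>
       (\<forall>\<^sub>F s in at t within K. \<Phi> s - F (h s) = \<Phi> t - F (h t)))"

lemma potential_on_subset: "potential_on S w f \<Longrightarrow> T \<subseteq> S \<Longrightarrow> potential_on T w f"
  by (auto simp: potential_on_def)

lemma potential_on_continuous_on: "potential_on S w f \<Longrightarrow> continuous_on S f"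
  unfolding potential_on_def
  by (meson continuous_at_imp_continuous_on has_derivative_continuous)

lemma potential_on_unique:
  assumes "potential_on S w f" "potential_on S w g" "convex S" "x \<in> S" "y \<in> S"
  shows "f x - g x = f y - g y"
proof -
  have "((\<lambda>z. f z - g z) has_derivative (\<lambda>v. 0)) (at z within S)" if "z \<in> S" for z
  proof (rule has_derivative_at_withinI)
    have "((\<lambda>z. f z - g z) has_derivative (\<lambda>v. w z \<bullet> v - w z \<bullet> v)) (at z)"
      using assms(1,2) that unfolding potential_on_def by (intro has_derivative_diff) auto
    then show "((\<lambda>z. f z - g z) has_derivative (\<lambda>v. 0)) (at z)" by simp
  qed
  then obtain k where "\<And>z. z \<in> S \<Longrightarrow> f z - g z = k"
    using has_derivative_zero_constant[OF \<open>convex S\<close>, of "\<lambda>z. f z - g z"] by blast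
  then show ?thesis using assms(4,5) by simp
qed

text \<open>On a ball inside both domains two potentials of \<open>w\<close> differ by a constant,
  and by continuity \<open>h\<close> stays in this ball near \<open>t\<close>.\<close>

lemma primitive_along_potential:
  assumes "continuous_on K h" "open B" "h ` K \<subseteq> B" "potential_on B w F"
  shows "primitive_along w h K (\<lambda>t. F (h t))"
  unfolding primitive_along_def
proof (intro ballI allI impI)
  fix t C G assume t: "t \<in> K" and C: "open C" "h t \<in> C" "potential_on C w G"
  obtain r where r: "r > 0" "ball (h t) r \<subseteq> B \<inter> C"
    using assms(2,3) C t by (metis IntI image_subset_iff open_Int openE)
  have "\<forall>\<^sub>F s in at t within K. h s \<in> ball (h t) r"
    using assms(1) t r(1) by (intro topological_tendstoD) (auto simp: continuous_on)
  then show "\<forall>\<^sub>F s in at t within K. F (h s) - G (h s) = F (h t) - G (h t)"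
  proof eventually_elim
    case (elim s)
    show ?case
      by (rule potential_on_unique[of "ball (h t) r" w])
        (use elim r assms(4) C(3) in \<open>auto intro: potential_on_subset\<close>)
  qed
qed

text \<open>Near each point both primitives follow the same local potential, so their difference is
  locally constant, hence constant on the connected set \<open>K\<close>.\<close>

lemma primitive_along_unique:
  assumes "primitive_along w h K \<Phi>" "primitive_along w h K \<Psi>" "connected K"
    and loc: "\<And>t. t \<in> K \<Longrightarrow> \<exists>B F. open B \<and> h t \<in> B \<and> potential_on B w F"
    and "s \<in> K" "t \<in> K"
  shows "\<Phi> s - \<Phi> t = \<Psi> s - \<Psi> t"
proof -
  have "\<forall>\<^sub>F s in at t within K. \<Phi> t - \<Psi> t = \<Phi> s - \<Psi> s" if "t \<in> K" for t
  proof -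
    obtain B F where "open B" "h t \<in> B" "potential_on B w F" using loc \<open>t \<in> K\<close> by blast
    then have "\<forall>\<^sub>F s in at t within K. \<Phi> s - F (h s) = \<Phi> t - F (h t)"
      "\<forall>\<^sub>F s in at t within K. \<Psi> s - F (h s) = \<Psi> t - F (h t)"
      using assms(1,2) that unfolding primitive_along_def by blast+
    then show ?thesis by eventually_elim argo
  qed
  then have "\<Phi> t - \<Psi> t = \<Phi> s - \<Psi> s"
    using connected_local_const[OF assms(3) \<open>t \<in> K\<close> \<open>s \<in> K\<close>, where f="\<lambda>t. \<Phi> t - \<Psi> t"] by simp
  then show ?thesis by simp
qed

lemma primitive_along_compose:
  assumes "primitive_along w h K \<Phi>" "continuous_on L k" "k ` L \<subseteq> K"
  shows "primitive_along w (h \<circ> k) L (\<Phi> \<circ> k)"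
  unfolding primitive_along_def
proof (intro ballI allI impI)
  fix t B F assume t: "t \<in> L" and B: "open B" "(h \<circ> k) t \<in> B" "potential_on B w F"
  have "\<forall>\<^sub>F s in at (k t) within K. \<Phi> s - F (h s) = \<Phi> (k t) - F (h (k t))"
    using assms(1,3) t B unfolding primitive_along_def by auto
  then obtain U where U: "open U" "k t \<in> U"
    "\<And>s. s \<in> U \<Longrightarrow> s \<noteq> k t \<Longrightarrow> s \<in> K \<Longrightarrow> \<Phi> s - F (h s) = \<Phi> (k t) - F (h (k t))"
    unfolding eventually_at_topological by blast
  have "\<forall>\<^sub>F s in at t within L. k s \<in> U"
    using assms(2) t U by (intro topological_tendstoD) (auto simp: continuous_on)
  moreover have "\<forall>\<^sub>F s in at t within L. s \<in> L"
    by (simp add: eventually_at_topological) (use open_UNIV in blast)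
  ultimately show "\<forall>\<^sub>F s in at t within L. (\<Phi> \<circ> k) s - F ((h \<circ> k) s) = (\<Phi> \<circ> k) t - F ((h \<circ> k) t)"
  proof eventually_elim
    case (elim s)
    \<comment> \<open>The filter \<open>at (k t) within K\<close> omits the point
      \<open>k t\<close>, so the case \<open>k s = k t\<close> is separate; there both sides are
      identical.\<close>
    then show ?case using U(3)[of "k s"] assms(3) by (cases "k s = k t") auto
  qed
qed

lemma primitive_along_shift:
  "primitive_along w h K \<Phi> \<Longrightarrow> primitive_along w h K (\<lambda>t. \<Phi> t + c)"
  unfolding primitive_along_def by (simp add: algebra_simps)

lemma primitive_along_cong:
  assumes "primitive_along w h K \<Phi>" "\<And>t. t \<in> K \<Longrightarrow> h t = h' t" "\<And>t. t \<in> K \<Longrightarrow> \<Phi> t = \<Phi>' t"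
  shows "primitive_along w h' K \<Phi>'"
  unfolding primitive_along_def
proof (intro ballI allI impI)
  fix t B F assume "t \<in> K" "open B" "h' t \<in> B" "potential_on B w F"
  then have "\<forall>\<^sub>F s in at t within K. \<Phi> s - F (h s) = \<Phi> t - F (h t)"
    using assms unfolding primitive_along_def by simp
  then show "\<forall>\<^sub>F s in at t within K. \<Phi>' s - F (h' s) = \<Phi>' t - F (h' t)"
    unfolding eventually_at_topological using assms(2,3) \<open>t \<in> K\<close> by metis
qed

text \<open>On the connected overlap the two primitives differ by a constant; shifting one of them
  by it allows gluing.\<close>

lemma primitive_along_Un:
  assumes "primitive_along w h K \<Phi>" "primitive_along w h L \<Psi>" "closed K" "closed L"
    and "connected (K \<inter> L)" "continuous_on (K \<union> L) h"
    and loc: "\<And>t. t \<in> K \<union> L \<Longrightarrow> \<exists>B F. open B \<and> h t \<in> B \<and> potential_on B w F"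
  obtains \<Theta> where "primitive_along w h (K \<union> L) \<Theta>"
proof -
  obtain c where c: "\<And>t. t \<in> K \<inter> L \<Longrightarrow> \<Phi> t = \<Psi> t + c"
  proof (cases "K \<inter> L = {}")
    case True then show ?thesis using that by auto
  next
    case False
    then obtain t\<^sub>0 where t\<^sub>0: "t\<^sub>0 \<in> K \<inter> L" by blast
    have K: "primitive_along w h (K \<inter> L) \<Phi>" "primitive_along w h (K \<inter> L) \<Psi>"
      using primitive_along_compose[OF assms(1), of "K \<inter> L" "\<lambda>x. x"]
        primitive_along_compose[OF assms(2), of "K \<inter> L" "\<lambda>x. x"] by (auto simp: o_def)
    have "\<Phi> t - \<Phi> t\<^sub>0 = \<Psi> t - \<Psi> t\<^sub>0" if "t \<in> K \<inter> L" for t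
      using primitive_along_unique[OF K \<open>connected (K \<inter> L)\<close> loc that t\<^sub>0] by blast
    then have "\<Phi> t = \<Psi> t + (\<Phi> t\<^sub>0 - \<Psi> t\<^sub>0)" if "t \<in> K \<inter> L" for t using that by fastforce
    then show ?thesis using that by blast
  qed
  define \<Theta> where "\<Theta> t = (if t \<in> K then \<Phi> t else \<Psi> t + c)" for t
  have K: "primitive_along w h K \<Theta>"
    by (rule primitive_along_cong[OF assms(1)]) (auto simp: \<Theta>_def)
  have L: "primitive_along w h L \<Theta>"
    by (rule primitive_along_cong[OF primitive_along_shift[OF assms(2), of c]]) (auto simp: \<Theta>_def c)
  have "primitive_along w h (K \<union> L) \<Theta>"
    unfolding primitive_along_def
  proof (intro ballI allI impI)
    fix t B F assume t: "t \<in> K \<union> L" and B: "open B" "h t \<in> B" "potential_on B w F"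
    \<comment> \<open>A point outside the closed set \<open>J\<close> has a neighbourhood that
      misses \<open>J\<close>, so the condition is vacuous there. The filter on the union then
      splits into the filters on the two pieces.\<close>
    have "\<forall>\<^sub>F s in at t within J. \<Theta> s - F (h s) = \<Theta> t - F (h t)"
      if J: "closed J" "primitive_along w h J \<Theta>" for J
    proof (cases "t \<in> J")
      case True
      then show ?thesis using J B unfolding primitive_along_def by blast
    next
      case False
      then show ?thesis
        using J(1) unfolding eventually_at_topological closed_def by (meson ComplD ComplI)
    qed
    then show "\<forall>\<^sub>F s in at t within K \<union> L. \<Theta> s - F (h s) = \<Theta> t - F (h t)"
      using K L assms(3,4) by (simp add: at_within_union eventually_sup)
  qed
  then show thesis using that by blast
qed

text \<open>A small rectangle is mapped into the domain of one local potential, and adjacent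
  rectangles are glued along their common edge. Bisection in the first coordinate gives thin strips,
  bisection in the second the square.\<close>

lemma primitive_along_square:
  fixes h :: "real \<times> real \<Rightarrow> 'n::real_inner"
  assumes h: "continuous_on ({0..1} \<times> {0..1}) h"
    and loc: "\<And>t. t \<in> {0..1} \<times> {0..1} \<Longrightarrow> \<exists>B F. open B \<and> h t \<in> B \<and> potential_on B w F"
  obtains \<Phi> where "primitive_along w h ({0..1} \<times> {0..1}) \<Phi>"
proof -
  \<comment> \<open>\<open>Bolzano\<close> asks about all short intervals around a point, also those
    leaving \<open>[0, 1]\<close>; \<open>good\<close> holds vacuously for rectangles that stick
    out.\<close>
  define good where "good a b c d \<longleftrightarrow> (0 \<le> a \<and> b \<le> 1 \<and> 0 \<le> c \<and> d \<le> 1 \<longrightarrow>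
    (\<exists>\<Phi>. primitive_along w h ({a..b} \<times> {c..d}) \<Phi>))" for a b c d :: real
  have glue: "\<exists>\<Theta>. primitive_along w h (K \<union> L) \<Theta>"
    if "\<exists>\<Phi>. primitive_along w h K \<Phi>" "\<exists>\<Phi>. primitive_along w h L \<Phi>" "closed K" "closed L"
      "connected (K \<inter> L)" "K \<union> L \<subseteq> {0..1} \<times> {0..1}" for K L
    using that primitive_along_Un[of w h K _ L] loc continuous_on_subset[OF h that(6)]
    by (metis subsetD)
  have conn: "connected ({a..b::real} \<times> {c..d::real})" for a b c d
    by (intro convex_connected convex_Times) auto
  have glue1: "good a b' c d" if "good a b c d" "good b b' c d" "a \<le> b" "b \<le> b'" for a b b' c d
    unfolding good_def
  proof (intro impI)
    assume *: "0 \<le> a \<and> b' \<le> 1 \<and> 0 \<le> c \<and> d \<le> 1"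
    have "({a..b} \<times> {c..d}) \<inter> ({b..b'} \<times> {c..d}) = {b..b} \<times> {c..d}" using that by auto
    then have "\<exists>\<Phi>. primitive_along w h (({a..b} \<times> {c..d}) \<union> ({b..b'} \<times> {c..d})) \<Phi>"
      using that * conn[of b b c d] unfolding good_def
      by (intro glue closed_Times) auto
    moreover have "({a..b} \<times> {c..d}) \<union> ({b..b'} \<times> {c..d}) = {a..b'} \<times> {c..d}" using that by auto
    ultimately show "\<exists>\<Phi>. primitive_along w h ({a..b'} \<times> {c..d}) \<Phi>" by simp
  qed
  have glue2: "good a b c d'" if "good a b c d" "good a b d d'" "c \<le> d" "d \<le> d'" for a b c d d'
    unfolding good_def
  proof (intro impI)
    assume *: "0 \<le> a \<and> b \<le> 1 \<and> 0 \<le> c \<and> d' \<le> 1"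
    have "({a..b} \<times> {c..d}) \<inter> ({a..b} \<times> {d..d'}) = {a..b} \<times> {d..d}" using that by auto
    then have "\<exists>\<Phi>. primitive_along w h (({a..b} \<times> {c..d}) \<union> ({a..b} \<times> {d..d'})) \<Phi>"
      using that * conn[of a b d d] unfolding good_def
      by (intro glue closed_Times) auto
    moreover have "({a..b} \<times> {c..d}) \<union> ({a..b} \<times> {d..d'}) = {a..b} \<times> {c..d'}" using that by auto
    ultimately show "\<exists>\<Phi>. primitive_along w h ({a..b} \<times> {c..d'}) \<Phi>" by simp
  qed
  have small: "\<exists>\<delta>>0. \<forall>a b c d. a \<le> x \<and> x \<le> b \<and> b - a < \<delta> \<and> c \<le> y \<and> y \<le> d \<and> d - c < \<delta> \<longrightarrow> good a b c d"
    if xy: "0 \<le> x" "x \<le> 1" "0 \<le> y" "y \<le> 1" for x y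
  proof -
    obtain B F where B: "open B" "h (x, y) \<in> B" "potential_on B w F"
      using loc[of "(x, y)"] xy by auto
    obtain e where e: "e > 0" "\<And>z. z \<in> {0..1} \<times> {0..1} \<Longrightarrow> dist z (x, y) < e \<Longrightarrow> h z \<in> B"
    proof -
      have "\<forall>\<^sub>F z in at (x, y) within {0..1} \<times> {0..1}. h z \<in> B"
        using h xy B by (intro topological_tendstoD) (auto simp: continuous_on)
      then obtain e where "e > 0" "\<forall>z\<in>{0..1} \<times> {0..1}. z \<noteq> (x, y) \<and> dist z (x, y) < e \<longrightarrow> h z \<in> B"
        unfolding eventually_at by blast
      then show ?thesis using that B(2) by metis
    qed
    \<comment> \<open>Side lengths below \<open>e / 2\<close> keep the rectangle within distance
      \<open>e\<close> of \<open>(x, y)\<close>, since the distance is at most the sum of the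
      coordinate differences.\<close>
    have "good a b c d" if *: "a \<le> x \<and> x \<le> b \<and> b - a < e / 2 \<and> c \<le> y \<and> y \<le> d \<and> d - c < e / 2" for a b c d
      unfolding good_def
    proof
      assume **: "0 \<le> a \<and> b \<le> 1 \<and> 0 \<le> c \<and> d \<le> 1"
      have sub: "{a..b} \<times> {c..d} \<subseteq> {0..1} \<times> {0..1}" using ** by auto
      have "h z \<in> B" if z: "z \<in> {a..b} \<times> {c..d}" for z
      proof (rule e(2))
        have "dist z (x, y) \<le> \<bar>fst z - x\<bar> + \<bar>snd z - y\<bar>"
          unfolding dist_prod_def using sqrt_sum_squares_le_sum_abs[of "fst z - x" "snd z - y"]
          by (simp add: dist_real_def)
        also have "\<dots> < e" using z * by (auto simp: abs_if)
        finally show "dist z (x, y) < e" .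
      qed (use z sub in blast)
      then show "\<exists>\<Phi>. primitive_along w h ({a..b} \<times> {c..d}) \<Phi>"
        using primitive_along_potential[OF continuous_on_subset[OF h sub] B(1) _ B(3)] by blast
    qed
    then show ?thesis using e(1) by (intro exI[of _ "e / 2"]) auto
  qed
  have strip: "\<exists>\<delta>>0. \<forall>c d. c \<le> y \<and> y \<le> d \<and> d - c < \<delta> \<longrightarrow> good 0 1 c d"
    if y: "0 \<le> y" "y \<le> 1" for y
  proof -
    \<comment> \<open>The admissible height \<open>\<delta>\<close> may depend on \<open>a\<close>
      and \<open>b\<close>. Gluing takes the minimum, so bisection yields one height for the full
      width.\<close>
    define P where "P a b \<longleftrightarrow> (\<exists>\<delta>>0. \<forall>c d. c \<le> y \<and> y \<le> d \<and> d - c < \<delta> \<longrightarrow> good a b c d)" for a b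
    have "P 0 1"
    proof (rule Bolzano[where P=P])
      fix a b b' assume ab: "P a b" "P b b'" "a \<le> b" "b \<le> b'"
      obtain \<delta> \<delta>' where "\<delta> > 0" "\<forall>c d. c \<le> y \<and> y \<le> d \<and> d - c < \<delta> \<longrightarrow> good a b c d"
        "\<delta>' > 0" "\<forall>c d. c \<le> y \<and> y \<le> d \<and> d - c < \<delta>' \<longrightarrow> good b b' c d"
        using ab unfolding P_def by blast
      then have "\<forall>c d. c \<le> y \<and> y \<le> d \<and> d - c < min \<delta> \<delta>' \<longrightarrow> good a b' c d" "min \<delta> \<delta>' > 0"
        using glue1[of a b _ _ b'] ab(3,4) by simp_all
      then show "P a b'"
        unfolding P_def by blast
    next
      fix x :: real assume "0 \<le> x" "x \<le> 1"
      from small[OF this y] obtain \<delta> where "\<delta> > 0"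
        "\<forall>a b c d. a \<le> x \<and> x \<le> b \<and> b - a < \<delta> \<and> c \<le> y \<and> y \<le> d \<and> d - c < \<delta> \<longrightarrow> good a b c d"
        by blast
      then have "P a b" if "a \<le> x \<and> x \<le> b \<and> b - a < \<delta>" for a b
        unfolding P_def using that \<open>\<delta> > 0\<close> by blast
      then show "\<exists>d>0. \<forall>a b. a \<le> x \<and> x \<le> b \<and> b - a < d \<longrightarrow> P a b"
        using \<open>\<delta> > 0\<close> by blast
    qed simp
    then show ?thesis unfolding P_def .
  qed
  have "good 0 1 0 1"
  proof (rule Bolzano[where P="good 0 1"])
    show "good 0 1 a d" if "good 0 1 a b" "good 0 1 b d" "a \<le> b" "b \<le> d" for a b d
      using that by (rule glue2)
    show "\<exists>\<delta>>0. \<forall>c d. c \<le> y \<and> y \<le> d \<and> d - c < \<delta> \<longrightarrow> good 0 1 c d" if "0 \<le> y" "y \<le> 1" for y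
      using that by (rule strip)
  qed simp
  then show thesis using that unfolding good_def by auto
qed

text \<open>The potential at \<open>y\<close> is the increment of a primitive along any path from a
  base point to \<open>y\<close>. Paths with the same end points are homotopic, and a primitive over
  the homotopy square shows that the increments agree.\<close>

lemma simply_connected_imp_potential:
  fixes D :: "'n::euclidean_space set"
  assumes "open D" "simply_connected D"
    and loc: "\<And>y. y \<in> D \<Longrightarrow> \<exists>B F. open B \<and> y \<in> B \<and> potential_on B w F"
  obtains f where "potential_on D w f"
proof (cases "D = {}")
  case True
  then show ?thesis using that[of "\<lambda>_. 0"] by (simp add: potential_on_def)
next
  case False
  then obtain x\<^sub>0 where x\<^sub>0: "x\<^sub>0 \<in> D" by blast
  define J where "J p y \<longleftrightarrow> path p \<and> path_image p \<subseteq> D \<and> pathstart p = x\<^sub>0 \<and> pathfinish p = y"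
    for p :: "real \<Rightarrow> 'n" and y
  have J_exists: "\<exists>p. J p y" if "y \<in> D" for y
    using simply_connected_imp_path_connected[OF assms(2)] x\<^sub>0 that
    unfolding path_connected_def J_def by blast
  have prim: "\<exists>\<Phi>. primitive_along w p {0..1} \<Phi>" if "J p y" for p y
  proof -
    have p: "continuous_on {0..1} p" "p ` {0..1} \<subseteq> D"
      using that by (auto simp: J_def path_def path_image_def)
    \<comment> \<open>A path is read as a map of the square that is constant in the second variable,
      so that \<open>primitive_along_square\<close> also serves for paths.\<close>
    have "continuous_on ({0..1} \<times> {0..1::real}) (p \<circ> fst)"
      using p(1) by (intro continuous_on_compose) (auto intro: continuous_intros continuous_on_subset)
    moreover have "\<exists>B F. open B \<and> (p \<circ> fst) t \<in> B \<and> potential_on B w F"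
      if "t \<in> {0..1} \<times> {0..1::real}" for t
      using loc p(2) that by (auto simp: image_subset_iff)
    ultimately obtain \<Phi> where \<Phi>: "primitive_along w (p \<circ> fst) ({0..1} \<times> {0..1::real}) \<Phi>"
      using primitive_along_square by blast
    have "primitive_along w ((p \<circ> fst) \<circ> (\<lambda>t. (t, 0::real))) {0..1} (\<Phi> \<circ> (\<lambda>t. (t, 0)))"
      by (rule primitive_along_compose[OF \<Phi>]) (auto intro!: continuous_intros)
    then show ?thesis by (auto simp: o_def)
  qed
  have indep: "\<Phi> 1 - \<Phi> 0 = \<Psi> 1 - \<Psi> 0"
    if p: "J p y" "primitive_along w p {0..1} \<Phi>" and q: "J q y" "primitive_along w q {0..1} \<Psi>"
    for p q y \<Phi> \<Psi>
  proof -
    have "homotopic_paths D p q"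
      using assms(2) p(1) q(1) unfolding simply_connected_eq_homotopic_paths J_def by simp
    then obtain h where h: "continuous_on ({0..1} \<times> {0..1}) h" "h \<in> ({0..1} \<times> {0..1}) \<rightarrow> D"
      "\<And>x. x \<in> {0..1} \<Longrightarrow> h (0, x) = p x" "\<And>x. x \<in> {0..1} \<Longrightarrow> h (1, x) = q x"
      "\<And>t. t \<in> {0..1::real} \<Longrightarrow> h (t, 0) = pathstart p \<and> h (t, 1) = pathfinish p"
      unfolding homotopic_paths by (auto simp: pathstart_def pathfinish_def)
    have h_loc: "\<exists>B F. open B \<and> h t \<in> B \<and> potential_on B w F" if "t \<in> {0..1} \<times> {0..1}" for t
      using loc h(2) that by blast
    obtain \<Theta> where \<Theta>: "primitive_along w h ({0..1} \<times> {0..1}) \<Theta>"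
      using primitive_along_square[OF h(1) h_loc] by blast
    \<comment> \<open>Restricted to a side, \<open>\<Theta>\<close> is a primitive along the path
      there, so by uniqueness it has the increment of any other primitive along that path.\<close>
    have side: "\<Theta> (k 1) - \<Theta> (k 0) = \<Xi> 1 - \<Xi> 0"
      if k: "continuous_on {0..1} k" "k ` {0..1} \<subseteq> {0..1} \<times> {0..1}" "\<And>t. t \<in> {0..1} \<Longrightarrow> h (k t) = r t"
        and \<Xi>: "primitive_along w r {0..1} \<Xi>" for k r and \<Xi> :: "real \<Rightarrow> real"
    proof -
      have 1: "primitive_along w r {0..1} (\<Theta> \<circ> k)"
        using primitive_along_cong[OF primitive_along_compose[OF \<Theta> k(1,2)], of r] k(3) by simp
      have "\<exists>B F. open B \<and> r t \<in> B \<and> potential_on B w F" if "t \<in> {0..1}" for t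
        using h_loc[of "k t"] k(2,3) that by (auto simp: image_subset_iff)
      from primitive_along_unique[OF 1 \<Xi> _ this, of 1 0] show ?thesis by simp
    qed
    \<comment> \<open>The homotopy fixes the end points, so \<open>\<Theta>\<close> has zero
      increment on two opposite sides; hence the increments on the sides carrying \<open>p\<close>
      and \<open>q\<close> are equal.\<close>
    have const: "primitive_along w (\<lambda>_. z) {0..1} (\<lambda>_. 0)" for z
      by (simp add: primitive_along_def)
    have "\<Theta> (0, 1) - \<Theta> (0, 0) = \<Phi> 1 - \<Phi> 0"
      by (rule side[where k="\<lambda>t. (0, t)", OF _ _ _ p(2)]) (auto intro: continuous_intros simp: h(3))
    moreover have "\<Theta> (1, 1) - \<Theta> (1, 0) = \<Psi> 1 - \<Psi> 0"
      by (rule side[where k="\<lambda>t. (1, t)", OF _ _ _ q(2)]) (auto intro: continuous_intros simp: h(4))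
    moreover have "\<Theta> (1, 0) - \<Theta> (0, 0) = 0 - 0"
      by (rule side[where k="\<lambda>t. (t, 0)", OF _ _ _ const]) (auto intro: continuous_intros simp: h(5))
    moreover have "\<Theta> (1, 1) - \<Theta> (0, 1) = 0 - 0"
      by (rule side[where k="\<lambda>t. (t, 1)", OF _ _ _ const]) (auto intro: continuous_intros simp: h(5))
    ultimately show ?thesis by simp
  qed
  \<comment> \<open>The choice is harmless on \<open>D\<close> by \<open>indep\<close>. Outside
    \<open>D\<close> no admissible path exists and the value is arbitrary.\<close>
  define f where "f y = (SOME c. \<exists>p \<Phi>. J p y \<and> primitive_along w p {0..1} \<Phi> \<and> c = \<Phi> 1 - \<Phi> 0)" for y
  have f: "f y = \<Phi> 1 - \<Phi> 0" if "J p y" "primitive_along w p {0..1} \<Phi>" for p y \<Phi>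
  proof -
    have "\<exists>p' \<Phi>'. J p' y \<and> primitive_along w p' {0..1} \<Phi>' \<and> f y = \<Phi>' 1 - \<Phi>' 0"
      unfolding f_def by (rule someI_ex) (use that in blast)
    then show ?thesis using indep[OF that] by metis
  qed
  have "(f has_derivative (\<lambda>v. w x \<bullet> v)) (at x)" if x: "x \<in> D" for x
  proof -
    obtain B F where B: "open B" "x \<in> B" "potential_on B w F" using loc[OF x] by blast
    obtain r where r: "r > 0" "ball x r \<subseteq> B \<inter> D"
      using openE[OF open_Int[OF B(1) assms(1)]] B(2) x by blast
    have eq: "F y - F x + f x = f y" if y: "y \<in> ball x r" for y
    proof -
      obtain p where p: "J p x" using J_exists x by blast
      \<comment> \<open>Prolonging the path by a segment inside the ball changes the increment by
        that of the local potential \<open>F\<close>, so \<open>f\<close> and \<open>F\<close>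
        differ by a constant near \<open>x\<close>.\<close>
      define q where "q = p +++ linepath x y"
      have seg: "path_image (linepath x y) \<subseteq> ball x r"
        using y r(1) by (simp add: closed_segment_subset)
      have q: "J q y"
        using p seg r(2) unfolding J_def q_def by (auto simp: path_image_join)
      obtain \<Phi> where \<Phi>: "primitive_along w q {0..1} \<Phi>" using prim[OF q] by blast
      have "primitive_along w (q \<circ> (\<lambda>t. t / 2)) {0..1} (\<Phi> \<circ> (\<lambda>t. t / 2))"
        by (rule primitive_along_compose[OF \<Phi>]) (auto intro!: continuous_intros)
      then have "primitive_along w p {0..1} (\<Phi> \<circ> (\<lambda>t. t / 2))"
        by (rule primitive_along_cong) (auto simp: q_def joinpaths_def)
      from f[OF p this] have "f x = \<Phi> (1/2) - \<Phi> 0" by simp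
      moreover have "\<Phi> 1 - \<Phi> (1/2) = F y - F x"
      proof -
        have 1: "primitive_along w (q \<circ> (\<lambda>t. 1/2 + t/2)) {0..1} (\<Phi> \<circ> (\<lambda>t. 1/2 + t/2))"
          by (rule primitive_along_compose[OF \<Phi>]) (auto intro!: continuous_intros)
        have "q (1/2 + t/2) = linepath x y t" if "t \<in> {0..1}" for t
        \<comment> \<open>At the parameter 1/2 \<open>joinpaths\<close> still uses the first path,
          so for \<open>t = 0\<close> the value is the end point of \<open>p\<close>.\<close>
        proof (cases "t = 0")
          case True
          then show ?thesis using p by (simp add: q_def joinpaths_def J_def pathfinish_def linepath_def)
        next
          case False
          then show ?thesis using that by (simp add: q_def joinpaths_def)
        qed
        then have 1: "primitive_along w (linepath x y) {0..1} (\<Phi> \<circ> (\<lambda>t. 1/2 + t/2))"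
          by (intro primitive_along_cong[OF 1]) auto
        have 2: "primitive_along w (linepath x y) {0..1} (\<lambda>t. F (linepath x y t))"
          by (rule primitive_along_potential[OF _ B(1) _ B(3)])
            (use seg r(2) in \<open>auto simp: path_image_def\<close>)
        have "\<exists>B F. open B \<and> linepath x y t \<in> B \<and> potential_on B w F" if "t \<in> {0..1}" for t
          using loc seg r(2) that unfolding path_image_def by blast
        from primitive_along_unique[OF 1 2 _ this, of 1 0] show ?thesis
          by (simp add: linepath_def)
      qed
      ultimately show ?thesis using f[OF q \<Phi>] by simp
    qed
    have "((\<lambda>y. F y - F x + f x) has_derivative (\<lambda>v. w x \<bullet> v)) (at x)"
      using B unfolding potential_on_def by (auto intro!: derivative_eq_intros)
    then show ?thesis
      by (rule has_derivative_transform_within_open[OF _ open_ball, of _ _ _ _ x r]) (use r(1) eq in auto)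
  qed
  then show thesis using that unfolding potential_on_def by blast
qed

section \<open>The Poincare lemma\<close>

text \<open>The potential is the integral of \<open>w\<close> along the segment from a base point.
  Its derivative is computed under the integral sign, and closedness turns the result into a total
  derivative in the segment parameter.\<close>

lemma convex_imp_potential:
  fixes w :: "'n::euclidean_space \<Rightarrow> 'n"
  assumes S: "open S" "convex S"
    and w: "\<And>y. y \<in> S \<Longrightarrow> (w has_derivative blinfun_apply (w' y)) (at y)" "continuous_on S w'"
    and closed: "\<And>y u v. y \<in> S \<Longrightarrow> w' y u \<bullet> v = w' y v \<bullet> u"
  obtains f where "potential_on S w f"
proof (cases "S = {}")
  case True
  then show ?thesis using that by (simp add: potential_on_def)
next
  case False
  then obtain x\<^sub>0 where x\<^sub>0: "x\<^sub>0 \<in> S" by blast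
  define l where "l y t = x\<^sub>0 + t *\<^sub>R (y - x\<^sub>0)" for y and t :: real
  have l: "l y t \<in> S" if "y \<in> S" "t \<in> cbox 0 1" for y t
    using convexD_alt[OF S(2) x\<^sub>0 that(1), of t] that(2) by (simp add: l_def algebra_simps)
  \<comment> \<open>The derivative of the integrand with respect to \<open>y\<close>, as a bounded
    linear map, the form in which \<open>leibniz_rule\<close> uses it.\<close>
  define fx where "fx y t = t *\<^sub>R (blinfun_inner_left (y - x\<^sub>0) o\<^sub>L w' (l y t)) + blinfun_inner_right (w (l y t))"
    for y and t :: real
  define f where "f y = integral (cbox 0 1) (\<lambda>t::real. w (l y t) \<bullet> (y - x\<^sub>0))" for y
  have cont_w: "continuous_on S w"
    using w(1) by (meson continuous_at_imp_continuous_on has_derivative_continuous)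
  have "(f has_derivative (\<lambda>v. w y \<bullet> v)) (at y)" if y: "y \<in> S" for y
  proof -
    have "(f has_derivative integral (cbox 0 1) (fx y)) (at y within S)"
      unfolding f_def
    proof (rule leibniz_rule[OF _ _ _ y S(2)])
      show "((\<lambda>z. w (l z t) \<bullet> (z - x\<^sub>0)) has_derivative fx z t) (at z within S)"
        if z: "z \<in> S" "t \<in> cbox 0 1" for z t
      proof (rule has_derivative_at_withinI)
        have l': "((\<lambda>z. l z t) has_derivative (\<lambda>v. t *\<^sub>R v)) (at z)"
          unfolding l_def by (auto intro!: derivative_eq_intros)
        have "((\<lambda>z. w (l z t)) has_derivative (\<lambda>v. w' (l z t) (t *\<^sub>R v))) (at z)"
          using has_derivative_compose[OF l' w(1)[OF l[OF z]]] .
        then have "((\<lambda>z. w (l z t) \<bullet> (z - x\<^sub>0)) has_derivative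
            (\<lambda>v. w (l z t) \<bullet> v + w' (l z t) (t *\<^sub>R v) \<bullet> (z - x\<^sub>0))) (at z)"
          by (intro has_derivative_inner) (auto intro!: derivative_eq_intros)
        moreover have "(\<lambda>v. w (l z t) \<bullet> v + w' (l z t) (t *\<^sub>R v) \<bullet> (z - x\<^sub>0)) = blinfun_apply (fx z t)"
          by (simp add: fx_def fun_eq_iff blinfun.add_left blinfun.scaleR_left blinfun.scaleR_right)
        ultimately show "((\<lambda>z. w (l z t) \<bullet> (z - x\<^sub>0)) has_derivative fx z t) (at z)" by simp
      qed
      show "(\<lambda>t. w (l z t) \<bullet> (z - x\<^sub>0)) integrable_on cbox 0 1" if "z \<in> S" for z
      proof (rule integrable_continuous)
        have "continuous_on (cbox 0 1) (\<lambda>t. w (l z t))"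
          by (rule continuous_on_compose2[OF cont_w])
            (use l that in \<open>auto simp: l_def intro!: continuous_intros\<close>)
        then show "continuous_on (cbox 0 1) (\<lambda>t. w (l z t) \<bullet> (z - x\<^sub>0))"
          by (intro continuous_intros)
      qed
      have lc: "continuous_on (S \<times> cbox 0 1) (\<lambda>(z, t). l z t)"
        unfolding l_def case_prod_unfold by (intro continuous_intros)
      have "continuous_on (S \<times> cbox 0 1) (\<lambda>(z, t). w' (l z t))"
        "continuous_on (S \<times> cbox 0 1) (\<lambda>(z, t). w (l z t))"
        using continuous_on_compose2[OF w(2) lc] continuous_on_compose2[OF cont_w lc] l
        by (auto simp: case_prod_unfold image_subset_iff)
      then show "continuous_on (S \<times> cbox 0 1) (\<lambda>(z, t). fx z t)"
        unfolding fx_def case_prod_unfold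
        by (intro continuous_intros bounded_linear.continuous_on[OF bounded_linear_blinfun_inner_left]
          bounded_linear.continuous_on[OF bounded_linear_blinfun_inner_right]
          bounded_bilinear.continuous_on[OF bounded_bilinear_blinfun_compose])
    qed
    moreover have "blinfun_apply (integral (cbox 0 1) (fx y)) = (\<lambda>v. w y \<bullet> v)"
    proof
      fix v
      have cont: "continuous_on (cbox 0 1) (fx y)"
      proof -
        have lc: "continuous_on (cbox 0 1) (l y)" unfolding l_def by (intro continuous_intros)
        have "continuous_on (cbox 0 1) (\<lambda>t. w' (l y t))" "continuous_on (cbox 0 1) (\<lambda>t. w (l y t))"
          using continuous_on_compose2[OF w(2) lc] continuous_on_compose2[OF cont_w lc] l y
          by (auto simp: image_subset_iff)
        then show ?thesis
          unfolding fx_def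
          by (intro continuous_intros bounded_linear.continuous_on[OF bounded_linear_blinfun_inner_left]
            bounded_linear.continuous_on[OF bounded_linear_blinfun_inner_right]
            bounded_bilinear.continuous_on[OF bounded_bilinear_blinfun_compose])
      qed
      \<comment> \<open>By \<open>closed\<close>, \<open>fx y t v\<close> is the derivative in
        \<open>t\<close> of \<open>t * (w (l y t) \<bullet> v)\<close>. The factor \<open>t\<close>
        removes the boundary term at 0, and \<open>l y 1 = y\<close>.\<close>
      have "((\<lambda>t. fx y t v) has_integral (1 *\<^sub>R (w (l y 1) \<bullet> v) - 0 *\<^sub>R (w (l y 0) \<bullet> v))) {0..1}"
      proof (rule fundamental_theorem_of_calculus)
        fix t :: real assume t: "t \<in> {0..1}"
        have l': "(l y has_derivative (\<lambda>s. s *\<^sub>R (y - x\<^sub>0))) (at t)"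
          unfolding l_def by (auto intro!: derivative_eq_intros)
        have "l y t \<in> S" using l y t by simp
        then have "((\<lambda>t. w (l y t)) has_derivative (\<lambda>s. w' (l y t) (s *\<^sub>R (y - x\<^sub>0)))) (at t)"
          using has_derivative_compose[OF l' w(1)] by blast
        then have "((\<lambda>t. t *\<^sub>R (w (l y t) \<bullet> v)) has_derivative
            (\<lambda>s. t *\<^sub>R (w' (l y t) (s *\<^sub>R (y - x\<^sub>0)) \<bullet> v) + s *\<^sub>R (w (l y t) \<bullet> v))) (at t)"
          by (auto intro!: derivative_eq_intros)
        moreover have "(\<lambda>s. t *\<^sub>R (w' (l y t) (s *\<^sub>R (y - x\<^sub>0)) \<bullet> v) + s *\<^sub>R (w (l y t) \<bullet> v)) =
            (\<lambda>s. s *\<^sub>R fx y t v)"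
          using closed[OF \<open>l y t \<in> S\<close>, of v "y - x\<^sub>0"]
          by (simp add: fx_def fun_eq_iff blinfun.add_left blinfun.scaleR_left blinfun.scaleR_right distrib_left mult.left_commute)
        ultimately show "((\<lambda>t. t *\<^sub>R (w (l y t) \<bullet> v)) has_vector_derivative fx y t v) (at t within {0..1})"
          unfolding has_vector_derivative_def by (simp add: has_derivative_at_withinI)
      qed simp
      then show "integral (cbox 0 1) (fx y) v = w y \<bullet> v"
        using integrable_continuous[OF cont]
        by (subst blinfun_apply_integral) (auto simp: l_def dest: integral_unique)
    qed
    ultimately show ?thesis by (simp only: at_within_open[OF y S(1)])
  qed
  then show thesis using that unfolding potential_on_def by blast
qed

text \<open>Balls are convex, so a closed field has potentials locally; simple connectedness makes
  them global.\<close>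

lemma closed_field_imp_potential:
  fixes D :: "(real ^ 'n) set" and w :: "real ^ 'n \<Rightarrow> real ^ 'n"
  assumes D: "open D" "simply_connected D"
    and w: "\<And>i. C_k_on 1 D (\<lambda>y. w y $ i)"
    and closed: "\<And>y i j. y \<in> D \<Longrightarrow>
      frechet_derivative (\<lambda>y. w y $ i) (at y) (axis j 1) = frechet_derivative (\<lambda>y. w y $ j) (at y) (axis i 1)"
  obtains f where "potential_on D w f"
proof (rule simply_connected_imp_potential[OF D])
  define w' where "w' y = Blinfun (frechet_derivative w (at y))" for y
  have C: "C_k_on (Suc 0) D w" using C_k_on_vecI[OF D(1) w] by simp
  have w'_apply: "blinfun_apply (w' y) = frechet_derivative w (at y)" if "y \<in> D" for y
    unfolding w'_def using C_k_on_Suc_has_derivative[OF C that]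
    by (intro bounded_linear_Blinfun_apply has_derivative_bounded_linear)
  have w': "(w has_derivative blinfun_apply (w' y)) (at y)" if "y \<in> D" for y
    using C_k_on_Suc_has_derivative[OF C that] w'_apply[OF that] by simp
  have cont: "continuous_on D w'"
  proof (rule continuous_on_blinfun_componentwise)
    fix v
    have "continuous_on D (\<lambda>x. frechet_derivative w (at x) v)" using C by simp
    then show "continuous_on D (\<lambda>x. w' x v)" by (simp add: w'_apply cong: continuous_on_cong)
  qed
  \<comment> \<open>Closedness says that the Jacobian matrix is symmetric; basis expansion and an
    exchange of sums carry this over to arbitrary vectors.\<close>
  have sym: "w' y u \<bullet> v = w' y v \<bullet> u" if y: "y \<in> D" for y u v
  proof -
    have comp: "w' y a $ i = frechet_derivative (\<lambda>y. w y $ i) (at y) a" for a i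
      using frechet_derivative_at[OF bounded_linear.has_derivative[OF bounded_linear_vec_nth w'[OF y]], of i]
      by (simp add: fun_eq_iff)
    have exp: "w' y a $ i = (\<Sum>j\<in>UNIV. a $ j * (w' y (axis j 1) $ i))" for a i
    proof -
      have "w' y a = w' y (\<Sum>j\<in>UNIV. a $ j *\<^sub>R axis j 1)"
        using basis_expansion[of a] by (simp add: scalar_mult_eq_scaleR)
      then show ?thesis by (simp add: blinfun.sum_right blinfun.scaleR_right)
    qed
    have "w' y u \<bullet> v = (\<Sum>i\<in>UNIV. \<Sum>j\<in>UNIV. u $ j * (w' y (axis j 1) $ i) * v $ i)"
      by (simp add: inner_vec_def exp[of u] sum_distrib_right)
    also have "\<dots> = (\<Sum>i\<in>UNIV. \<Sum>j\<in>UNIV. u $ j * (w' y (axis i 1) $ j) * v $ i)"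
      using closed[OF y] by (simp add: comp)
    also have "\<dots> = (\<Sum>j\<in>UNIV. \<Sum>i\<in>UNIV. u $ j * (w' y (axis i 1) $ j) * v $ i)"
      by (rule sum.swap)
    also have "\<dots> = w' y v \<bullet> u"
      by (simp add: inner_vec_def exp[of v] sum_distrib_left sum_distrib_right mult.commute mult.left_commute)
    finally show ?thesis .
  qed
  show "\<exists>B F. open B \<and> y \<in> B \<and> potential_on B w F" if y: "y \<in> D" for y
  proof -
    obtain r where r: "r > 0" "ball y r \<subseteq> D" using openE[OF D(1) y] by blast
    obtain F where "potential_on (ball y r) w F"
      by (rule convex_imp_potential[of "ball y r" w w'])
        (use r w' sym continuous_on_subset[OF cont] in auto)
    then show ?thesis using r(1) by (meson centre_in_ball open_ball)
  qed
qed

text \<open>By the chain rule the integrand is the derivative of \<open>f \<circ> \<delta>\<close>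
  at interior parameters off a finite set. For the continuous \<open>f \<circ> \<delta>\<close> the
  fundamental theorem allows these exceptions.\<close>

lemma has_integral_potential_valid_path:
  fixes \<delta> :: "real \<Rightarrow> 'n::euclidean_space"
  assumes "potential_on D w f" "valid_path \<delta>" "path_image \<delta> \<subseteq> D"
  shows "((\<lambda>t. w (\<delta> t) \<bullet> vector_derivative \<delta> (at t within {0..1})) has_integral
    (f (pathfinish \<delta>) - f (pathstart \<delta>))) {0..1}"
proof -
  obtain X where X: "finite X" "\<delta> C1_differentiable_on {0..1} - X" and c: "continuous_on {0..1} \<delta>"
    using assms(2) unfolding valid_path_def piecewise_C1_differentiable_on_def by blast
  have "((\<lambda>t. w (\<delta> t) \<bullet> vector_derivative \<delta> (at t within {0..1})) has_integral
    ((f \<circ> \<delta>) 1 - (f \<circ> \<delta>) 0)) {0..1}"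
  proof (rule fundamental_theorem_of_calculus_interior_strong[OF X(1)])
    fix t :: real assume t: "t \<in> {0<..<1} - X"
    then have "\<delta> differentiable (at t)" using X(2) by (auto simp: C1_differentiable_on_eq)
    then have d: "(\<delta> has_vector_derivative vector_derivative \<delta> (at t)) (at t)"
      by (simp add: vector_derivative_works)
    \<comment> \<open>At interior parameters the derivative within \<open>{0..1}\<close> is the
      two-sided one.\<close>
    then have eq: "vector_derivative \<delta> (at t within {0..1}) = vector_derivative \<delta> (at t)"
      using t by (intro vector_derivative_at_within_ivl) auto
    have "\<delta> t \<in> D" using assms(3) t by (auto simp: path_image_def)
    then have "(f has_derivative (\<lambda>v. w (\<delta> t) \<bullet> v)) (at (\<delta> t))"
      using assms(1) by (simp add: potential_on_def)
    from has_derivative_compose[OF d[unfolded has_vector_derivative_def] this]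
    show "(f \<circ> \<delta> has_vector_derivative w (\<delta> t) \<bullet> vector_derivative \<delta> (at t within {0..1})) (at t)"
      by (simp add: eq has_vector_derivative_def o_def)
  next
    show "continuous_on {0..1} (f \<circ> \<delta>)"
      using assms(3) potential_on_continuous_on[OF assms(1)]
      by (intro continuous_on_compose c) (auto simp: path_image_def intro: continuous_on_subset)
  qed simp
  then show ?thesis by (simp add: pathfinish_def pathstart_def)
qed

section \<open>Partial derivatives and gradients\<close>

abbreviation pderiv_at :: "'m::finite \<Rightarrow> (real ^ 'm \<Rightarrow> real) \<Rightarrow> real ^ 'm \<Rightarrow> real" where
  "pderiv_at i f y \<equiv> frechet_derivative f (at y) (axis i 1)"

lemma potential_on_pderiv_at:
  assumes "potential_on S w f" "y \<in> S"
  shows "pderiv_at i f y = w y $ i"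
proof -
  have "(f has_derivative (\<lambda>v. w y \<bullet> v)) (at y)" using assms by (simp add: potential_on_def)
  from frechet_derivative_at[OF this, symmetric] show ?thesis by (simp add: inner_axis)
qed

lemma potential_onI_pderiv_at:
  assumes "\<And>y. y \<in> S \<Longrightarrow> f differentiable (at y)"
    and "\<And>y i. y \<in> S \<Longrightarrow> pderiv_at i f y = w y $ i"
  shows "potential_on S w f"
  unfolding potential_on_def
proof
  fix y assume y: "y \<in> S"
  then have f: "(f has_derivative frechet_derivative f (at y)) (at y)"
    using assms(1) by (simp flip: frechet_derivative_works)
  then have L: "linear (frechet_derivative f (at y))" by (rule has_derivative_linear)
  have "frechet_derivative f (at y) v = w y \<bullet> v" for v
  proof -
    have "frechet_derivative f (at y) v = frechet_derivative f (at y) (\<Sum>i\<in>UNIV. v $ i *\<^sub>R axis i 1)"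
      using basis_expansion[of v] by (simp add: scalar_mult_eq_scaleR)
    also have "\<dots> = w y \<bullet> v"
      using assms(2)[OF y] by (simp add: linear_sum[OF L] linear_cmul[OF L] inner_vec_def mult.commute)
    finally show ?thesis .
  qed
  then show "(f has_derivative (\<lambda>v. w y \<bullet> v)) (at y)" using f by presburger
qed

lemma potential_on_cong:
  assumes "open S" "potential_on S w f" "\<And>y. y \<in> S \<Longrightarrow> w y = w' y" "\<And>y. y \<in> S \<Longrightarrow> f y = f' y"
  shows "potential_on S w' f'"
  using assms has_derivative_transform_within_open[OF _ assms(1)] unfolding potential_on_def by metis

text \<open>Serves both to adjust integration constants and to antisymmetrise a family of
  potentials.\<close>

lemma potential_on_affine:
  assumes "potential_on S w f" "potential_on S w' f'"
  shows "potential_on S (\<lambda>y. k *\<^sub>R w y + l *\<^sub>R w' y) (\<lambda>y. k * f y + l * f' y + c)"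
  using assms unfolding potential_on_def
  by (auto intro!: derivative_eq_intros simp: inner_add_left)

lemma pderiv_at_add:
  assumes "f differentiable (at y)" "g differentiable (at y)"
  shows "pderiv_at i (\<lambda>y. f y + g y) y = pderiv_at i f y + pderiv_at i g y"
  using frechet_derivative_at[OF has_derivative_add[OF assms[unfolded frechet_derivative_works]]]
  by metis

lemma pderiv_at_diff:
  assumes "f differentiable (at y)" "g differentiable (at y)"
  shows "pderiv_at i (\<lambda>y. f y - g y) y = pderiv_at i f y - pderiv_at i g y"
  using frechet_derivative_at[OF has_derivative_diff[OF assms[unfolded frechet_derivative_works]]]
  by metis

lemma pderiv_at_half:
  assumes "f differentiable (at y)"
  shows "pderiv_at i (\<lambda>y. f y / 2) y = pderiv_at i f y / 2"
proof -
  have "((\<lambda>y. 1 / 2 * f y) has_derivative (\<lambda>v. 1 / 2 * frechet_derivative f (at y) v)) (at y)"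
    by (intro has_derivative_mult_right) (simp add: assms flip: frechet_derivative_works)
  from frechet_derivative_at[OF this, symmetric] show ?thesis by simp
qed

section \<open>Saint-Venant compatibility in Euclidean coordinates\<close>

text \<open>\<open>q i j\<close> is the \<open>p\<^sub>i\<^sub>j\<close> of the paper, the infinitesimal rotation of the displacement \<open>u\<close>.\<close>

definition strain_of :: "(real ^ 'm) set \<Rightarrow> ('m \<Rightarrow> real ^ 'm \<Rightarrow> real) \<Rightarrow> ('m::finite \<Rightarrow> 'm \<Rightarrow> real ^ 'm \<Rightarrow> real) \<Rightarrow> bool" where
  "strain_of D u E \<longleftrightarrow> (\<forall>y\<in>D. \<forall>i j. E i j y = 1 / 2 * (pderiv_at i (u j) y + pderiv_at j (u i) y))"

text \<open>If \<open>E\<close> is the strain of \<open>u\<close>, this is the gradient of the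
  rotation component with indices \<open>i\<close> and \<open>j\<close>.\<close>

definition rotation_gradient :: "('m::finite \<Rightarrow> 'm \<Rightarrow> real ^ 'm \<Rightarrow> real) \<Rightarrow> 'm \<Rightarrow> 'm \<Rightarrow> real ^ 'm \<Rightarrow> real ^ 'm" where
  "rotation_gradient E i j y = (\<chi> s. pderiv_at j (E i s) y - pderiv_at i (E j s) y)"

text \<open>The gradient of \<open>u i\<close>, split into its rotation part and its strain
  part.\<close>

definition displacement_gradient ::
  "('m::finite \<Rightarrow> 'm \<Rightarrow> real ^ 'm \<Rightarrow> real) \<Rightarrow> ('m \<Rightarrow> 'm \<Rightarrow> real ^ 'm \<Rightarrow> real) \<Rightarrow> 'm \<Rightarrow> real ^ 'm \<Rightarrow> real ^ 'm" where
  "displacement_gradient q E i y = (\<chi> s. q i s y + E i s y)"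

definition compatible :: "(real ^ 'm) set \<Rightarrow> ('m::finite \<Rightarrow> 'm \<Rightarrow> real ^ 'm \<Rightarrow> real) \<Rightarrow> bool" where
  "compatible D E \<longleftrightarrow> (\<forall>y\<in>D. \<forall>i j k l.
     pderiv_at l (pderiv_at j (E i k)) y + pderiv_at k (pderiv_at i (E j l)) y
     - pderiv_at l (pderiv_at i (E j k)) y - pderiv_at j (pderiv_at k (E i l)) y = 0)"

lemma C_k_on_differentiable: "C_k_on (Suc k) S f \<Longrightarrow> y \<in> S \<Longrightarrow> f differentiable (at y)"
  by simp

lemma C_k_on_rotation_gradient:
  assumes "open D" "\<And>i j. C_k_on (Suc k) D (E i j)"
  shows "C_k_on k D (\<lambda>y. rotation_gradient E i j y $ s)"
  unfolding rotation_gradient_def using assms by (simp add: C_k_on_diff)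

lemma pderiv_at_rotation_gradient:
  assumes "\<And>i j. C_k_on 2 D (E i j)" "y \<in> D"
  shows "pderiv_at k (\<lambda>y. rotation_gradient E i j y $ s) y =
    pderiv_at k (pderiv_at j (E i s)) y - pderiv_at k (pderiv_at i (E j s)) y"
  unfolding rotation_gradient_def using assms
  by (simp add: pderiv_at_diff numeral_2_eq_2)

text \<open>The Saint-Venant relations are the closedness of the rotation gradients; written out,
  the two differ only in the order of differentiation of \<open>E i l\<close>.\<close>

lemma compatible_iff:
  assumes "open D" "\<And>i j. C_k_on 2 D (E i j)"
  shows "compatible D E \<longleftrightarrow> (\<forall>y\<in>D. \<forall>i j k l.
    pderiv_at k (\<lambda>y. rotation_gradient E i j y $ l) y = pderiv_at l (\<lambda>y. rotation_gradient E i j y $ k) y)"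
proof -
  have "pderiv_at j (pderiv_at k (E i l)) y = pderiv_at k (pderiv_at j (E i l)) y" if "y \<in> D" for i j k l y
    using frechet_derivative_commute[OF assms(2,1) that] .
  then show ?thesis
    unfolding compatible_def using pderiv_at_rotation_gradient[OF assms(2)]
    by (intro ball_cong refl all_cong1) auto
qed

text \<open>The passage from a displacement to its strain. Commuting second derivatives of
  \<open>u\<close> identify the gradient of \<open>q i j\<close>; commuting those of
  \<open>q i j\<close> then gives compatibility.\<close>

lemma
  assumes D: "open D" and u: "\<And>i. C_k_on 3 D (u i)" and E: "strain_of D u E"
    and q: "\<And>i j. q i j = (\<lambda>y. 1 / 2 * (pderiv_at j (u i) y - pderiv_at i (u j) y))"
  shows strain_of_potential_rotation: "potential_on D (rotation_gradient E i j) (q i j)"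
    and strain_of_potential_displacement: "potential_on D (displacement_gradient q E i) (u i)"
    and strain_of_compatible: "compatible D E"
proof -
  have u2: "C_k_on 2 D (u i)" "C_k_on 2 D (pderiv_at j (u i))" for i j
    using u[of i] C_k_on_le[OF u, of 2 i] by (simp_all add: numeral_3_eq_3 numeral_2_eq_2)
  have d1: "u i differentiable (at y)" "pderiv_at j (u i) differentiable (at y)" if "y \<in> D" for i j y
    using u2[of i] that by (simp_all add: numeral_2_eq_2)
  have comm: "pderiv_at i (pderiv_at j (u k)) y = pderiv_at j (pderiv_at i (u k)) y" if "y \<in> D" for i j k y
    using frechet_derivative_commute[OF u2(1) D that] .
  have E': "E i j y = 1 / 2 * (pderiv_at i (u j) y + pderiv_at j (u i) y)" if "y \<in> D" for i j y
    using E that unfolding strain_of_def by blast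
  have E2: "C_k_on 2 D (E i j)" for i j
    using C_k_on_mult[OF D C_k_on_const[OF D] C_k_on_add[OF D u2(2) u2(2)]]
    by (subst C_k_on_cong[OF D E'])
  have pE: "pderiv_at k (E i j) y = 1 / 2 * (pderiv_at k (pderiv_at i (u j)) y + pderiv_at k (pderiv_at j (u i)) y)"
    if y: "y \<in> D" for i j k y
    by (subst frechet_derivative_cong_open[OF D y E'])
      (simp_all add: pderiv_at_half pderiv_at_add d1 y)
  have q2: "C_k_on 2 D (q i j)" for i j
    unfolding q using C_k_on_mult[OF D C_k_on_const[OF D] C_k_on_diff[OF D u2(2) u2(2)]] .
  have rot: "potential_on D (rotation_gradient E i j) (q i j)" for i j
  proof (rule potential_onI_pderiv_at)
    show "q i j differentiable (at y)" if "y \<in> D" for y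
      using q2[of i j] that by (simp add: numeral_2_eq_2)
    show "pderiv_at s (q i j) y = rotation_gradient E i j y $ s" if y: "y \<in> D" for y s
    proof -
      have "pderiv_at s (q i j) y = 1 / 2 * (pderiv_at s (pderiv_at j (u i)) y - pderiv_at s (pderiv_at i (u j)) y)"
        unfolding q using y by (simp add: pderiv_at_half pderiv_at_diff d1)
      moreover have "rotation_gradient E i j y $ s = pderiv_at j (E i s) y - pderiv_at i (E j s) y"
        by (simp add: rotation_gradient_def)
      \<comment> \<open>Expanding the strain, the mixed derivatives of \<open>u s\<close> cancel and
        the remaining terms form the derivative of \<open>q i j\<close>.\<close>
      ultimately show ?thesis
        using comm[OF y, where k=s and i=i and j=j] comm[OF y, where k=i and i=s and j=j]
          comm[OF y, where k=j and i=s and j=i]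
          pE[OF y, where k=j and i=i and j=s] pE[OF y, where k=i and i=j and j=s]
        by simp argo
    qed
  qed
  then show "potential_on D (rotation_gradient E i j) (q i j)" .
  show "potential_on D (displacement_gradient q E i) (u i)"
    by (rule potential_onI_pderiv_at)
      (simp_all add: d1 displacement_gradient_def q E' algebra_simps)
  have "pderiv_at k (\<lambda>y. rotation_gradient E i j y $ l) y = pderiv_at l (\<lambda>y. rotation_gradient E i j y $ k) y"
    if y: "y \<in> D" for i j k l y
  proof -
    have "pderiv_at k (pderiv_at l (q i j)) y = pderiv_at l (pderiv_at k (q i j)) y"
      using frechet_derivative_commute[OF q2 D y] .
    moreover have "pderiv_at k (pderiv_at l (q i j)) y = pderiv_at k (\<lambda>y. rotation_gradient E i j y $ l) y" for k l
      by (subst frechet_derivative_cong_open[OF D y potential_on_pderiv_at[OF rot]]) auto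
    ultimately show ?thesis by simp
  qed
  then show "compatible D E" using compatible_iff[where E=E, OF D E2] by blast
qed

text \<open>Symmetrising the gradient \<open>q + E\<close> removes the antisymmetric
  \<open>q\<close> and keeps \<open>E\<close>. Regularity is gained twice: \<open>E\<close> in
  \<open>C^2\<close> gives \<open>q\<close> in \<open>C^2\<close>, and then \<open>u\<close> in
  \<open>C^3\<close>.\<close>

lemma potential_imp_strain_of:
  assumes D: "open D" and E: "\<And>i j. C_k_on 2 D (E i j)"
    and E_sym: "\<And>y i j. y \<in> D \<Longrightarrow> E i j y = E j i y"
    and q: "\<And>i j. potential_on D (rotation_gradient E i j) (q i j)"
    and q_antisym: "\<And>y i j. y \<in> D \<Longrightarrow> q i j y = - q j i y"
    and u: "\<And>i. potential_on D (displacement_gradient q E i) (u i)"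
  shows "strain_of D u E" "C_k_on 3 D (u i)"
proof -
  show "strain_of D u E"
    unfolding strain_of_def
  proof (intro ballI allI)
    fix y i j assume y: "y \<in> D"
    show "E i j y = 1 / 2 * (pderiv_at i (u j) y + pderiv_at j (u i) y)"
      using E_sym[OF y, of i j] q_antisym[OF y, of i j]
      by (simp add: potential_on_pderiv_at[OF u y] displacement_gradient_def)
  qed
  have "C_k_on (Suc 1) D (q i j)" for i j
    using q[of i j] C_k_on_rotation_gradient[of D 1 E] E D
    by (intro C_k_on_Suc_gradient) (auto simp: potential_on_def numeral_2_eq_2)
  then have "C_k_on (Suc 2) D (u i)"
    using u[of i] E D
    by (intro C_k_on_Suc_gradient[where w="displacement_gradient q E i"])
      (auto simp: potential_on_def displacement_gradient_def numeral_2_eq_2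
        simp del: C_k_on.simps intro!: C_k_on_add)
  then show "C_k_on 3 D (u i)" by (simp add: numeral_3_eq_3 numeral_2_eq_2)
qed

lemma compatible_imp_potential_rotation:
  assumes D: "open D" "simply_connected D" and E: "\<And>i j. C_k_on 2 D (E i j)" "compatible D E"
  obtains q where "\<And>i j. potential_on D (rotation_gradient E i j) (q i j)"
    "\<And>i j y. q i j y = - q j i y"
proof -
  have "\<exists>f. potential_on D (rotation_gradient E i j) f" for i j
    by (rule closed_field_imp_potential[OF D, of "rotation_gradient E i j"])
      (use compatible_iff[where E=E, OF D(1) E(1)] E(2) C_k_on_rotation_gradient[OF D(1), of 1 E] E(1)
        in \<open>auto simp: numeral_2_eq_2\<close>)
  then obtain q where q: "\<And>i j. potential_on D (rotation_gradient E i j) (q i j)" by metis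
  show thesis
  proof
    \<comment> \<open>Potentials chosen separately for \<open>(i, j)\<close> and
      \<open>(j, i)\<close> need not be opposite. The field changes sign under the swap, so half
      their difference is an antisymmetric choice.\<close>
    show "potential_on D (rotation_gradient E i j) (\<lambda>y. 1/2 * q i j y + (- 1/2) * q j i y + 0)" for i j
      by (rule potential_on_cong[OF D(1) potential_on_affine[OF q q, of "1/2" i j "- 1/2" j i]])
        (auto simp: rotation_gradient_def vec_eq_iff algebra_simps)
  qed simp
qed

text \<open>Inserting the gradient of \<open>q\<close>, the \<open>k\<close>-th derivative of
  component \<open>j\<close> becomes an expression that is symmetric in \<open>j\<close> and
  \<open>k\<close> because \<open>E\<close> is symmetric; so the field is closed.\<close>

lemma potential_rotation_imp_displacement:
  assumes D: "open D" "simply_connected D" and E: "\<And>i j. C_k_on 2 D (E i j)"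
    and E_sym: "\<And>y i j. y \<in> D \<Longrightarrow> E i j y = E j i y"
    and q: "\<And>i j. potential_on D (rotation_gradient E i j) (q i j)"
  obtains f where "potential_on D (displacement_gradient q E i) f"
proof (rule closed_field_imp_potential[OF D])
  have q2: "C_k_on (Suc 1) D (q i j)" for i j
    using q[of i j] C_k_on_rotation_gradient[of D 1 E] E D
    by (intro C_k_on_Suc_gradient) (auto simp: potential_on_def numeral_2_eq_2)
  have E1: "C_k_on (Suc 1) D (E i j)" for i j using E by (simp add: numeral_2_eq_2)
  show "C_k_on 1 D (\<lambda>y. displacement_gradient q E i y $ j)" for j
    using C_k_on_add[OF D(1) C_k_on_Suc_imp[OF q2] C_k_on_Suc_imp[OF E1]]
    by (simp add: displacement_gradient_def)
  show "pderiv_at k (\<lambda>y. displacement_gradient q E i y $ j) y =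
      pderiv_at j (\<lambda>y. displacement_gradient q E i y $ k) y" if y: "y \<in> D" for y j k
  proof -
    have "pderiv_at k (\<lambda>y. displacement_gradient q E i y $ j) y =
        pderiv_at j (E i k) y - pderiv_at i (E j k) y + pderiv_at k (E i j) y" for j k
      using C_k_on_differentiable[OF q2 y] C_k_on_differentiable[OF E1 y]
      by (simp add: displacement_gradient_def pderiv_at_add potential_on_pderiv_at[OF q y] rotation_gradient_def)
    moreover have "pderiv_at i (E j k) y = pderiv_at i (E k j) y"
      using frechet_derivative_cong_open[OF D(1) y, of "E j k" "E k j"] E_sym by simp
    ultimately show ?thesis by simp
  qed
qed

text \<open>The raised vector sits in the first slot of \<open>metric_inner\<close>, so symmetry of
  \<open>A\<close> is what lets \<open>A\<close> cancel its inverse.\<close>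

lemma metric_inner_raise_index:
  fixes A :: "real ^ 'm ^ 'm"
  assumes "det A \<noteq> 0" "\<And>i j. A $ i $ j = A $ j $ i"
  shows "metric_inner A (\<chi> l. \<Sum>s\<in>UNIV. matrix_inv A $ l $ s * x $ s) v = x \<bullet> v"
proof -
  let ?r = "\<chi> l. \<Sum>s\<in>UNIV. matrix_inv A $ l $ s * x $ s"
  have "?r = matrix_inv A *v x" by (simp add: matrix_vector_mult_def)
  then have r: "A *v ?r = x"
    using assms(1) by (simp add: matrix_vector_mul_assoc matrix_inv_mult invertible_det_nz)
  have "metric_inner A ?r v = (\<Sum>j\<in>UNIV. \<Sum>i\<in>UNIV. A $ i $ j * ?r $ i * v $ j)"
    unfolding metric_inner_def by (rule sum.swap)
  also have "\<dots> = (\<Sum>j\<in>UNIV. (A *v ?r) $ j * v $ j)"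
    by (simp only: matrix_vector_mult_def vec_lambda_beta sum_distrib_right assms(2))
  also have "\<dots> = x \<bullet> v" unfolding r by (simp add: inner_vec_def)
  finally show ?thesis .
qed

lemma matrix_vector_mult_eq_iff_inv:
  fixes A :: "real ^ 'm ^ 'm"
  assumes "det A \<noteq> 0"
  shows "A *v v = x \<longleftrightarrow> v = matrix_inv A *v x"
  using assms by (metis invertible_det_nz matrix_inv_mult matrix_vector_mul_assoc matrix_vector_mul_lid)

section \<open>Transfer to the chart\<close>

text \<open>The data of a single chart restricted to \<open>\<Omega>\<close>, with positive
  definiteness recorded as \<open>G_det\<close>. Everything below takes place on the coordinate
  image of \<open>\<Omega>\<close>.\<close>

locale riemannian_patch =
  fixes c :: "('a::{t2_space, second_countable_topology}, 'm::finite) chart"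
    and G e :: "'a \<Rightarrow> real ^ 'm ^ 'm"
    and \<Omega> :: "'a set"
  assumes open_image: "open (snd c ` \<Omega>)"
    and simply_connected_image: "simply_connected (snd c ` \<Omega>)"
    and chart_inv_chart: "p \<in> \<Omega> \<Longrightarrow> chart_inv c (snd c p) = p"
    and continuous_chart_inv: "continuous_on (snd c ` \<Omega>) (chart_inv c)"
    and G_sym: "p \<in> \<Omega> \<Longrightarrow> G p $ i $ j = G p $ j $ i"
    and G_det: "p \<in> \<Omega> \<Longrightarrow> det (G p) \<noteq> 0"
    and G_smooth: "C_k_on k (snd c ` \<Omega>) (G \<circ> chart_inv c)"
    and e_C2: "C_k_in_chart 2 c \<Omega> (\<lambda>p. e p $ i $ j)"
    and e_sym: "p \<in> \<Omega> \<Longrightarrow> e p $ i $ j = e p $ j $ i"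
begin

abbreviation "D \<equiv> snd c ` \<Omega>"

abbreviation "\<psi> \<equiv> chart_inv c"

definition "E i j y = e (\<psi> y) $ i $ j"

text \<open>The covariant components of \<open>V\<close>, in which the system no longer involves the
  metric.\<close>

definition lower :: "('a \<Rightarrow> real ^ 'm) \<Rightarrow> 'm \<Rightarrow> real ^ 'm \<Rightarrow> real" where
  "lower V i y = (\<Sum>k\<in>UNIV. G (\<psi> y) $ i $ k * V (\<psi> y) $ k)"

lemma inv_D: "y \<in> D \<Longrightarrow> \<psi> y \<in> \<Omega>" "y \<in> D \<Longrightarrow> snd c (\<psi> y) = y"
  using chart_inv_chart by auto

lemma E_C2: "C_k_on 2 D (E i j)"
  using e_C2[of i j] by (simp add: C_k_in_chart_def E_def[abs_def] o_def)

lemma E_sym: "y \<in> D \<Longrightarrow> E i j y = E j i y"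
  using e_sym inv_D by (simp add: E_def)

lemma E_chart: "p \<in> \<Omega> \<Longrightarrow> E i j (snd c p) = e p $ i $ j"
  by (simp add: E_def chart_inv_chart)

lemma partial_e: "partial c k (\<lambda>q. e q $ i $ j) p = pderiv_at k (E i j) (snd c p)"
  by (simp add: partial_def E_def[abs_def] o_def)

text \<open>The inner partial derivatives agree only on the open set \<open>D\<close>, which
  suffices because the outer derivative is local.\<close>

lemma partial_partial_e:
  assumes "p \<in> \<Omega>"
  shows "partial c l (partial c k (\<lambda>q. e q $ i $ j)) p = pderiv_at l (pderiv_at k (E i j)) (snd c p)"
  unfolding partial_def[of c l]
  by (subst frechet_derivative_cong_open[OF open_image, of "snd c p" _ "pderiv_at k (E i j)"])
    (use assms in \<open>auto simp: partial_e chart_inv_chart\<close>)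

lemma saint_venant_iff: "saint_venant c \<Omega> e \<longleftrightarrow> compatible D E"
  by (simp add: saint_venant_def compatible_def partial_partial_e)

text \<open>Class \<open>C^3\<close> passes in both directions between \<open>V\<close> and its
  covariant components, since the entries of the metric and of its inverse are smooth.\<close>

lemma is_solution_iff:
  "is_solution c G \<Omega> e V \<longleftrightarrow> strain_of D (lower V) E \<and> (\<forall>i. C_k_on 3 D (lower V i))"
proof -
  have "sym_grad c G V p = e p \<longleftrightarrow>
      (\<forall>i j. E i j (snd c p) = 1 / 2 * (pderiv_at i (lower V j) (snd c p) + pderiv_at j (lower V i) (snd c p)))"
    if "p \<in> \<Omega>" for p
    using that by (auto simp: vec_eq_iff sym_grad_def partial_def E_chart lower_def[abs_def] o_def)
  then have 1: "(\<forall>p\<in>\<Omega>. sym_grad c G V p = e p) \<longleftrightarrow> strain_of D (lower V) E"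
    by (auto simp: strain_of_def)
  have Gij: "C_k_on k D (\<lambda>y. G (\<psi> y) $ i $ j)" for k i j
    using C_k_on_vec_nth[OF open_image C_k_on_vec_nth[OF open_image G_smooth]] by (simp add: o_def)
  have inv: "C_k_on k D (\<lambda>y. matrix_inv (G (\<psi> y)) $ i $ j)" for k i j
    using inv_D G_det by (intro C_k_on_matrix_inv open_image Gij) auto
  have 2: "C_k_in_chart 3 c \<Omega> V \<longleftrightarrow> (\<forall>i. C_k_on 3 D (lower V i))"
  proof
    assume "C_k_in_chart 3 c \<Omega> V"
    then have "C_k_on 3 D (\<lambda>y. V (\<psi> y) $ k)" for k
      using C_k_on_vec_nth[OF open_image, of 3 "V \<circ> \<psi>"] by (simp add: C_k_in_chart_def o_def)
    then show "\<forall>i. C_k_on 3 D (lower V i)"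
      unfolding lower_def[abs_def] by (intro allI C_k_on_sum C_k_on_mult open_image Gij)
  next
    assume *: "\<forall>i. C_k_on 3 D (lower V i)"
    have "C_k_on 3 D (\<lambda>y. (V \<circ> \<psi>) y $ k)" for k
    proof (subst C_k_on_cong[OF open_image])
      show "(V \<circ> \<psi>) y $ k = (\<Sum>s\<in>UNIV. matrix_inv (G (\<psi> y)) $ k $ s * lower V s y)" if "y \<in> D" for y
      proof -
        have "G (\<psi> y) *v V (\<psi> y) = (\<chi> s. lower V s y)"
          by (simp add: matrix_vector_mult_def lower_def)
        then have "V (\<psi> y) = matrix_inv (G (\<psi> y)) *v (\<chi> s. lower V s y)"
          using matrix_vector_mult_eq_iff_inv G_det inv_D(1)[OF that] by blast
        then have "V (\<psi> y) $ k = (matrix_inv (G (\<psi> y)) *v (\<chi> s. lower V s y)) $ k" by simp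
        then show ?thesis by (simp add: matrix_vector_mult_def)
      qed
      show "C_k_on 3 D (\<lambda>y. \<Sum>s\<in>UNIV. matrix_inv (G (\<psi> y)) $ k $ s * lower V s y)"
        using * by (intro C_k_on_sum C_k_on_mult open_image inv) auto
    qed
    then show "C_k_in_chart 3 c \<Omega> V"
      unfolding C_k_in_chart_def by (rule C_k_on_vecI[OF open_image])
  qed
  show ?thesis unfolding is_solution_def 1 2 by blast
qed

section \<open>The representation formula in the chart\<close>

lemma V_formula_iff:
  assumes "p \<in> \<Omega>"
  shows "V p = V_formula c G e \<gamma> a b p \<longleftrightarrow> (\<forall>i. lower V i (snd c p) = u_coeff c G e \<gamma> a b i p)"
proof -
  have "V_formula c G e \<gamma> a b p = matrix_inv (G p) *v (\<chi> i. u_coeff c G e \<gamma> a b i p)"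
    by (simp add: V_formula_def matrix_vector_mult_def)
  moreover have "G p *v V p = (\<chi> i. lower V i (snd c p))"
    using assms by (simp add: matrix_vector_mult_def lower_def chart_inv_chart)
  ultimately show ?thesis
    using matrix_vector_mult_eq_iff_inv[OF G_det[OF assms], of "V p" "\<chi> i. u_coeff c G e \<gamma> a b i p"]
    by (simp add: vec_eq_iff)
qed

text \<open>The metric cancels the raised index, leaving a Euclidean line integral of a gradient,
  which depends on the end points only.\<close>

lemma curve_integral_potential:
  assumes "curve_joining c \<Omega> x\<^sub>0 x \<gamma>" "potential_on D (\<lambda>y. X (\<psi> y)) f"
  shows "curve_integral c G (\<lambda>p. \<chi> l. \<Sum>s\<in>UNIV. matrix_inv (G p) $ l $ s * X p $ s) \<gamma> =
    f (snd c x) - f (snd c x\<^sub>0)"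
proof -
  have \<gamma>: "valid_path (snd c \<circ> \<gamma>)" "\<And>t. t \<in> {0..1} \<Longrightarrow> \<gamma> t \<in> \<Omega>" "\<gamma> 0 = x\<^sub>0" "\<gamma> 1 = x"
    using assms(1) by (auto simp: curve_joining_def path_image_def pathstart_def pathfinish_def)
  have "curve_integral c G (\<lambda>p. \<chi> l. \<Sum>s\<in>UNIV. matrix_inv (G p) $ l $ s * X p $ s) \<gamma> =
      integral {0..1} (\<lambda>t. X (\<psi> ((snd c \<circ> \<gamma>) t)) \<bullet> vector_derivative (snd c \<circ> \<gamma>) (at t within {0..1}))"
    unfolding curve_integral_def
  proof (rule integral_cong)
    show "metric_inner (G (\<gamma> t)) (\<chi> l. \<Sum>s\<in>UNIV. matrix_inv (G (\<gamma> t)) $ l $ s * X (\<gamma> t) $ s) (velocity c \<gamma> t) =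
        X (\<psi> ((snd c \<circ> \<gamma>) t)) \<bullet> vector_derivative (snd c \<circ> \<gamma>) (at t within {0..1})"
      if "t \<in> {0..1}" for t
      using \<gamma>(2)[OF that]
      by (subst metric_inner_raise_index) (auto intro: G_sym simp: G_det velocity_def chart_inv_chart)
  qed
  also have "\<dots> = f (pathfinish (snd c \<circ> \<gamma>)) - f (pathstart (snd c \<circ> \<gamma>))"
    by (rule integral_unique, rule has_integral_potential_valid_path[OF assms(2) \<gamma>(1)])
      (use \<gamma>(2) in \<open>auto simp: path_image_def\<close>)
  finally show ?thesis by (simp add: pathfinish_def pathstart_def \<gamma>)
qed

lemma p_coeff_potential:
  assumes "curve_joining c \<Omega> x\<^sub>0 x (\<gamma> x)" "potential_on D (rotation_gradient E i j) f"
  shows "p_coeff c G e \<gamma> b i j x = b $ i $ j + f (snd c x) - f (snd c x\<^sub>0)"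
proof -
  have "potential_on D (\<lambda>y. rotation_gradient E i j (snd c (\<psi> y))) f"
    by (rule potential_on_cong[OF open_image assms(2)]) (simp_all only: inv_D)
  from curve_integral_potential[where X="\<lambda>p. rotation_gradient E i j (snd c p)", OF assms(1) this]
  show ?thesis
    unfolding p_coeff_def W_field_def[abs_def] by (simp add: partial_e rotation_gradient_def)
qed

lemma u_coeff_potential:
  assumes "curve_joining c \<Omega> x\<^sub>0 x (\<gamma> x)" "potential_on D (displacement_gradient q E i) f"
    and "\<And>j p. p \<in> \<Omega> \<Longrightarrow> q i j (snd c p) = p_coeff c G e \<gamma> b i j p"
  shows "u_coeff c G e \<gamma> a b i x = a $ i + f (snd c x) - f (snd c x\<^sub>0)"
proof -
  have "potential_on D (\<lambda>y. \<chi> s. p_coeff c G e \<gamma> b i s (\<psi> y) + e (\<psi> y) $ i $ s) f"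
    by (rule potential_on_cong[OF open_image assms(2)])
      (simp_all add: displacement_gradient_def E_def vec_eq_iff inv_D flip: assms(3))
  from curve_integral_potential[where X="\<lambda>p. \<chi> s. p_coeff c G e \<gamma> b i s p + e p $ i $ s", OF assms(1) this]
  show ?thesis
    unfolding u_coeff_def U_field_def[abs_def] by simp
qed

lemma solution_imp_V_formula:
  assumes \<gamma>: "\<And>x. x \<in> \<Omega> \<Longrightarrow> curve_joining c \<Omega> x\<^sub>0 x (\<gamma> x)"
    and V: "is_solution c G \<Omega> e V"
  shows "\<exists>a b. (\<forall>i j. b $ i $ j = - b $ j $ i) \<and> (\<forall>x\<in>\<Omega>. V x = V_formula c G e \<gamma> a b x)"
proof -
  define q where "q i j = (\<lambda>y. 1 / 2 * (pderiv_at j (lower V i) y - pderiv_at i (lower V j) y))" for i j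
  have V': "\<And>i. C_k_on 3 D (lower V i)" "strain_of D (lower V) E" using V is_solution_iff by auto
  note rot = strain_of_potential_rotation[OF open_image V' q_def]
    and disp = strain_of_potential_displacement[OF open_image V' q_def]
  \<comment> \<open>The curve integrals are increments from the base point, so the integration
    constants are the values there. The antisymmetry of \<open>b\<close> is inherited from
    \<open>q\<close>.\<close>
  define a where "a = (\<chi> i. lower V i (snd c x\<^sub>0))"
  define b where "b = (\<chi> i j. q i j (snd c x\<^sub>0))"
  have "p_coeff c G e \<gamma> b i j x = q i j (snd c x)" if "x \<in> \<Omega>" for i j x
    using p_coeff_potential[where \<gamma>=\<gamma>, OF \<gamma>[OF that] rot] by (simp add: b_def)
  then have "u_coeff c G e \<gamma> a b i x = lower V i (snd c x)" if "x \<in> \<Omega>" for i x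
    using u_coeff_potential[where \<gamma>=\<gamma> and b=b and a=a, OF \<gamma>[OF that] disp] by (simp add: a_def)
  then have "\<forall>x\<in>\<Omega>. V x = V_formula c G e \<gamma> a b x" by (simp add: V_formula_iff)
  moreover have "b $ i $ j = - b $ j $ i" for i j by (simp add: b_def q_def field_simps)
  ultimately show ?thesis by blast
qed

text \<open>Antisymmetric constants \<open>b\<close> keep the rotation antisymmetric, so that it
  drops out of the symmetric gradient; the constants \<open>a\<close> have no effect on it.\<close>

lemma V_formula_imp_solution:
  assumes \<gamma>: "\<And>x. x \<in> \<Omega> \<Longrightarrow> curve_joining c \<Omega> x\<^sub>0 x (\<gamma> x)"
    and sv: "saint_venant c \<Omega> e" and b: "\<And>i j. b $ i $ j = - b $ j $ i"
    and V: "\<And>x. x \<in> \<Omega> \<Longrightarrow> V x = V_formula c G e \<gamma> a b x"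
  shows "is_solution c G \<Omega> e V"
proof -
  obtain Q where Q: "\<And>i j. potential_on D (rotation_gradient E i j) (Q i j)"
    "\<And>i j y. Q i j y = - Q j i y"
    using compatible_imp_potential_rotation[where E=E, OF open_image simply_connected_image E_C2] sv saint_venant_iff by blast
  \<comment> \<open>Normalised to have the value \<open>b\<close> at the base point, so that it
    coincides with \<open>p_coeff\<close>.\<close>
  define q where "q i j y = b $ i $ j + Q i j y - Q i j (snd c x\<^sub>0)" for i j y
  have q: "potential_on D (rotation_gradient E i j) (q i j)" for i j
    using potential_on_affine[OF Q(1) Q(1), of 1 i j 0 i j "b $ i $ j - Q i j (snd c x\<^sub>0)"]
    by (rule potential_on_cong[OF open_image]) (auto simp: q_def)
  have q_antisym: "q i j y = - q j i y" for i j y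
    using Q(2)[of i j] b[of i j] by (simp add: q_def)
  have p: "p_coeff c G e \<gamma> b i j x = q i j (snd c x)" if "x \<in> \<Omega>" for i j x
    using p_coeff_potential[where \<gamma>=\<gamma>, OF \<gamma>[OF that] Q(1)] by (simp add: q_def)
  have "\<exists>f. potential_on D (displacement_gradient q E i) f" for i
    using potential_rotation_imp_displacement[where E=E, OF open_image simply_connected_image E_C2 E_sym q] by blast
  then obtain U where U: "\<And>i. potential_on D (displacement_gradient q E i) (U i)" by metis
  have "u_coeff c G e \<gamma> a b i x = a $ i + U i (snd c x) - U i (snd c x\<^sub>0)" if "x \<in> \<Omega>" for i x
    using u_coeff_potential[where \<gamma>=\<gamma>, OF \<gamma>[OF that] U] p by simp
  then have lower: "lower V i (snd c x) = a $ i + U i (snd c x) - U i (snd c x\<^sub>0)" if "x \<in> \<Omega>" for i x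
    using V that V_formula_iff[OF that] by metis
  have "potential_on D (displacement_gradient q E i) (lower V i)" for i
    using potential_on_affine[OF U U, of 1 i 0 i "a $ i - U i (snd c x\<^sub>0)"]
    by (rule potential_on_cong[OF open_image]) (auto simp: lower)
  then show ?thesis
    unfolding is_solution_iff
    using potential_imp_strain_of[where E=E, OF open_image E_C2 E_sym q q_antisym] by blast
qed

text \<open>A polynomial path in the connected open set \<open>D\<close> is pulled back to
  \<open>\<Omega>\<close>. In the chart the curve is again this polynomial on \<open>{0..1}\<close>,
  so continuity of \<open>\<psi>\<close> is enough.\<close>

lemma curve_joining_exists:
  assumes "x \<in> \<Omega>" "y \<in> \<Omega>"
  shows "\<exists>\<gamma>. curve_joining c \<Omega> x y \<gamma>"
proof -
  obtain g where g: "polynomial_function g" "path_image g \<subseteq> D" "pathstart g = snd c x" "pathfinish g = snd c y"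
    using connected_open_polynomial_connected[OF open_image simply_connected_imp_connected[OF simply_connected_image]]
      assms by (metis imageI)
  have gD: "g t \<in> D" if "t \<in> {0..1}" for t using g(2) that by (auto simp: path_image_def)
  have cont: "continuous_on {0..1} g" using g(1) by (simp add: continuous_on_polymonial_function)
  have eq: "snd c (\<psi> (g t)) = g t" if "t \<in> {0..1}" for t using inv_D gD that by blast
  have "path (\<psi> \<circ> g)"
    unfolding path_def using cont gD
    by (intro continuous_on_compose continuous_on_subset[OF continuous_chart_inv]) auto
  moreover have "valid_path (snd c \<circ> (\<psi> \<circ> g))"
    unfolding valid_path_def piecewise_C1_differentiable_on_def
    \<comment> \<open>\<open>g\<close> may leave \<open>D\<close> outside \<open>{0..1}\<close>, so the end points are exceptional.\<close>
  proof (intro conjI exI[of _ "{0, 1}"])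
    show "continuous_on {0..1} (snd c \<circ> (\<psi> \<circ> g))"
      using cont by (rule continuous_on_eq) (simp add: eq)
    obtain g' where g': "polynomial_function g'" "\<And>t. (g has_vector_derivative g' t) (at t)"
      using has_vector_derivative_polynomial_function[OF g(1)] by blast
    have "(snd c \<circ> (\<psi> \<circ> g) has_vector_derivative g' t) (at t)" if "t \<in> {0..1} - {0, 1}" for t
      by (rule has_vector_derivative_transform_within_open[OF g'(2), where S="{0<..<1}"])
        (use that eq in auto)
    then show "snd c \<circ> (\<psi> \<circ> g) C1_differentiable_on {0..1} - {0, 1}"
      unfolding C1_differentiable_on_def using g'(1) continuous_on_polymonial_function by blast
  qed simp
  moreover have "path_image (\<psi> \<circ> g) \<subseteq> \<Omega>" using gD inv_D by (auto simp: path_image_def)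
  moreover have "pathstart (\<psi> \<circ> g) = x" "pathfinish (\<psi> \<circ> g) = y"
    using g(3,4) assms by (simp_all add: pathstart_compose pathfinish_compose chart_inv_chart)
  ultimately show ?thesis unfolding curve_joining_def by blast
qed

lemma solution_exists_iff: "(\<exists>V. is_solution c G \<Omega> e V) \<longleftrightarrow> saint_venant c \<Omega> e"
proof
  assume "\<exists>V. is_solution c G \<Omega> e V"
  then obtain V where V: "is_solution c G \<Omega> e V" ..
  then have V': "\<And>i. C_k_on 3 D (lower V i)" "strain_of D (lower V) E" by (simp_all only: is_solution_iff)
  show "saint_venant c \<Omega> e"
    unfolding saint_venant_iff by (rule strain_of_compatible[OF open_image V' refl])
next
  assume sv: "saint_venant c \<Omega> e"
  show "\<exists>V. is_solution c G \<Omega> e V"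
  \<comment> \<open>On the empty set there is no base point for the formula, but every field is a
    solution.\<close>
  proof (cases "\<Omega> = {}")
    case True
    then show ?thesis by (simp add: is_solution_def C_k_in_chart_def C_k_on_empty)
  next
    case False
    then obtain x\<^sub>0 where "x\<^sub>0 \<in> \<Omega>" by blast
    then obtain \<gamma> where "\<And>x. x \<in> \<Omega> \<Longrightarrow> curve_joining c \<Omega> x\<^sub>0 x (\<gamma> x)"
      using curve_joining_exists by metis
    then have "is_solution c G \<Omega> e (V_formula c G e \<gamma> 0 0)"
      by (rule V_formula_imp_solution[OF _ sv]) simp_all
    then show ?thesis by blast
  qed
qed

end

text \<open>The chart is a homeomorphism onto an open set, so openness and simple connectedness of
  \<open>\<Omega>\<close> pass to its image.\<close>

lemma (in riemannian_manifold) riemannian_patchI: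
  assumes c: "c \<in> A" and \<Omega>: "openin (top_of_set M) \<Omega>" "simply_connected \<Omega>" "\<Omega> \<subseteq> fst c"
    and e: "\<And>i j. C_k_in_chart 2 c \<Omega> (\<lambda>p. e p $ i $ j)" "\<And>p i j. p \<in> \<Omega> \<Longrightarrow> e p $ i $ j = e p $ j $ i"
  shows "riemannian_patch c (g c) e \<Omega>"
proof -
  have chart: "openin (top_of_set M) (fst c)" "open (snd c ` fst c)"
    "homeomorphism (fst c) (snd c ` fst c) (snd c) (chart_inv c)"
    using charts[OF c] by (auto simp: topological_chart_def)
  have hom: "homeomorphism \<Omega> (snd c ` \<Omega>) (snd c) (chart_inv c)"
    using homeomorphism_of_subsets[OF chart(3) \<Omega>(3)] \<Omega>(3) by blast
  have "openin (top_of_set (fst c)) \<Omega>"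
    using openin_subset_trans[OF \<Omega>(1,3)] chart(1) openin_imp_subset by blast
  then have "openin (top_of_set (snd c ` fst c)) (snd c ` \<Omega>)"
    using homeomorphism_imp_open_map[OF chart(3)] by blast
  then have op: "open (snd c ` \<Omega>)" using chart(2) openin_open_eq by blast
  show ?thesis
  proof
    show "open (snd c ` \<Omega>)" by (rule op)
    show "simply_connected (snd c ` \<Omega>)"
      using homeomorphic_simply_connected[OF _ \<Omega>(2)] hom homeomorphic_def by blast
    show "chart_inv c (snd c p) = p" if "p \<in> \<Omega>" for p
      using hom that by (simp add: homeomorphism_def)
    show "continuous_on (snd c ` \<Omega>) (chart_inv c)" using hom by (simp add: homeomorphism_def)
    show "g c p $ i $ j = g c p $ j $ i" if "p \<in> \<Omega>" for p i j
      using symmetric[OF c] that \<Omega>(3) by blast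
    show "det (g c p) \<noteq> 0" if "p \<in> \<Omega>" for p
    proof -
      \<comment> \<open>Positive definiteness makes the kernel trivial, hence the matrix is
        invertible.\<close>
      have "v = 0" if "g c p *v v = 0" for v
        using positive_definite[OF c, of p v] that \<Omega>(3) \<open>p \<in> \<Omega>\<close> by auto
      then show ?thesis
        using matrix_left_invertible_ker[of "g c p"] invertible_left_inverse[of "g c p"]
        by (simp add: invertible_det_nz)
    qed
    show "C_k_on k (snd c ` \<Omega>) (g c \<circ> chart_inv c)" for k
      using C_k_on_subset[OF smooth_metric[OF c] image_mono[OF \<Omega>(3)]] .
  qed (use e in auto)
qed

theorem proposition2p1:
  fixes M :: "'a::{t2_space, second_countable_topology} set"
    and A :: "('a, 'm::finite) chart set"
    and g :: "('a, 'm) chart \<Rightarrow> 'a \<Rightarrow> real ^ 'm ^ 'm"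
    and c :: "('a, 'm) chart"
    and \<Omega> :: "'a set"
    and e :: "'a \<Rightarrow> real ^ 'm ^ 'm"
  assumes "riemannian_manifold M A g"
    and "c \<in> A"
    and "openin (top_of_set M) \<Omega>"
    and "simply_connected \<Omega>"
    and "\<Omega> \<subseteq> fst c"
    and "\<And>i j. C_k_in_chart 2 c \<Omega> (\<lambda>p. e p $ i $ j)"
    and "\<And>p i j. p \<in> \<Omega> \<Longrightarrow> e p $ i $ j = e p $ j $ i"
  shows "((\<exists>V. is_solution c (g c) \<Omega> e V) \<longleftrightarrow> saint_venant c \<Omega> e) \<and>
    (\<forall>x\<^sub>0\<in>\<Omega>. saint_venant c \<Omega> e \<longrightarrow>
      (\<forall>\<gamma>. (\<forall>x\<in>\<Omega>. curve_joining c \<Omega> x\<^sub>0 x (\<gamma> x)) \<longrightarrow>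
        (\<forall>V. is_solution c (g c) \<Omega> e V \<longleftrightarrow>
          (\<exists>a b. (\<forall>i j. b $ i $ j = - b $ j $ i) \<and>
            (\<forall>x\<in>\<Omega>. V x = V_formula c (g c) e \<gamma> a b x)))))"
proof -
  interpret riemannian_patch c "g c" e \<Omega>
    using riemannian_manifold.riemannian_patchI[OF assms] .
  have "is_solution c (g c) \<Omega> e V \<longleftrightarrow> (\<exists>a b. (\<forall>i j. b $ i $ j = - b $ j $ i) \<and>
      (\<forall>x\<in>\<Omega>. V x = V_formula c (g c) e \<gamma> a b x))"
    if "saint_venant c \<Omega> e" "\<forall>x\<in>\<Omega>. curve_joining c \<Omega> x\<^sub>0 x (\<gamma> x)" for x\<^sub>0 \<gamma> V
    using solution_imp_V_formula[of x\<^sub>0 \<gamma> V] V_formula_imp_solution[of x\<^sub>0 \<gamma> _ V] that by blast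
  with solution_exists_iff show ?thesis by blast
qed

end
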